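(* Let $G = \prod_{k \geq 3} S_k^{a_k}$ be a tower group. Then $$\operatorname{LatAut}(G) \;\cong\; S_{a_4} \times S_B, \qquad B = \sum_{\substack{k \geq 3 \\ k \neq 4}} a_k .$$
   Context: All groups are finite. $S_n$ denotes the symmetric group on $n$ letters, with the convention $S_0 = S_1 = 1$. A tower group is a finite group isomorphic to $\prod_{k \geq 3} S_k^{a_k}$, where the $a_k \geq 0$ are integers and only finitely many of them are nonzero. For a finite group $G$, $\mathcal{N}(G)$ is the lattice of normal subgroups of $G$ ordered by inclusion (meet $H \wedge K = H \cap K$, join $H \vee K = HK$). $\operatorname{LatAut}(G) = \operatorname{Aut}(\mathcal{N}(G))$ is the group, under composition, of all bijections $\varphi : \mathcal{N}(G) \to \mathcal{N}(G)$ such that $H \leq K \Leftrightarrow \varphi(H) \leq \varphi(K)$ for all $H, K \in \mathcal{N}(G)$. *)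

theory Defs
  imports "HOL-Algebra.Algebra"
begin

text \<open>The infinite index set is harmless: for a k = 0 the inner product is trivial.\<close>

definition symmetric_product :: "(nat \<Rightarrow> nat) \<Rightarrow> (nat \<Rightarrow> nat \<Rightarrow> nat \<Rightarrow> nat) monoid"
  where "symmetric_product a =
    product_group {3..} (\<lambda>k. product_group {..<a k} (\<lambda>_. sym_group k))"

text \<open>Values of the multiplicity function at 0, 1 and 2 are irrelevant. Finiteness of the
  group follows from the finite support of the multiplicities.\<close>

definition tower_group :: "(nat \<Rightarrow> nat) \<Rightarrow> ('g, 'm) monoid_scheme \<Rightarrow> bool"
  where "tower_group a G \<longleftrightarrow>
    group G \<and> finite {k. 3 \<le> k \<and> a k \<noteq> 0} \<and> G \<cong> symmetric_product a"

definition normal_subgroup_lattice :: "('g, 'm) monoid_scheme \<Rightarrow> 'g set gorder"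
  where "normal_subgroup_lattice G =
    \<lparr>carrier = {H. H \<lhd> G}, eq = (=), le = (\<subseteq>)\<rparr>"

definition order_auto :: "('l, 'm) gorder_scheme \<Rightarrow> ('l \<Rightarrow> 'l) set"
  where "order_auto L =
    {\<phi> \<in> Bij (carrier L).
      \<forall>x \<in> carrier L. \<forall>y \<in> carrier L. x \<sqsubseteq>\<^bsub>L\<^esub> y \<longleftrightarrow> \<phi> x \<sqsubseteq>\<^bsub>L\<^esub> \<phi> y}"

definition OrderAutoGroup :: "('l, 'm) gorder_scheme \<Rightarrow> ('l \<Rightarrow> 'l) monoid"
  where "OrderAutoGroup L = BijGroup (carrier L) \<lparr>carrier := order_auto L\<rparr>"

definition LatAut :: "('g, 'm) monoid_scheme \<Rightarrow> ('g set \<Rightarrow> 'g set) monoid"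
  where "LatAut G = OrderAutoGroup (normal_subgroup_lattice G)"

lemma group_OrderAutoGroup: "group (OrderAutoGroup L)"
proof -
  let ?C = "carrier L"
  interpret B: group "BijGroup ?C" by (rule group_BijGroup)
  have "subgroup (order_auto L) (BijGroup ?C)"
  proof (rule B.subgroupI)
    show "order_auto L \<subseteq> carrier (BijGroup ?C)"
      by (auto simp: order_auto_def BijGroup_def)
    show "order_auto L \<noteq> {}"
      using id_Bij[of ?C] by (auto simp: order_auto_def intro!: exI[of _ "\<lambda>x\<in>?C. x"])
  next
    fix f assume f: "f \<in> order_auto L"
    then have fB: "f \<in> Bij ?C" by (simp add: order_auto_def)
    then have inv: "inv_into ?C f x \<in> ?C" "f (inv_into ?C f x) = x" if "x \<in> ?C" for x
      using that by (auto simp: Bij_def bij_betw_def f_inv_into_f inv_into_into)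
    have "x \<sqsubseteq>\<^bsub>L\<^esub> y \<longleftrightarrow> inv_into ?C f x \<sqsubseteq>\<^bsub>L\<^esub> inv_into ?C f y"
      if "x \<in> ?C" "y \<in> ?C" for x y
    proof -
      have "inv_into ?C f x \<sqsubseteq>\<^bsub>L\<^esub> inv_into ?C f y
          \<longleftrightarrow> f (inv_into ?C f x) \<sqsubseteq>\<^bsub>L\<^esub> f (inv_into ?C f y)"
        using f inv(1)[OF that(1)] inv(1)[OF that(2)] unfolding order_auto_def by blast
      then show ?thesis using inv(2) that by simp
    qed
    then show "inv\<^bsub>BijGroup ?C\<^esub> f \<in> order_auto L"
      unfolding inv_BijGroup[OF fB] using restrict_inv_into_Bij[OF fB]
      by (simp add: order_auto_def)
  next
    fix f g assume fg: "f \<in> order_auto L" "g \<in> order_auto L"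
    then have B: "f \<in> Bij ?C" "g \<in> Bij ?C" by (simp_all add: order_auto_def)
    then have "g x \<in> ?C" if "x \<in> ?C" for x
      using that by (metis Bij_imp_funcset funcset_mem)
    with fg have "x \<sqsubseteq>\<^bsub>L\<^esub> y \<longleftrightarrow> f (g x) \<sqsubseteq>\<^bsub>L\<^esub> f (g y)" if "x \<in> ?C" "y \<in> ?C" for x y
      using that unfolding order_auto_def by blast
    then show "f \<otimes>\<^bsub>BijGroup ?C\<^esub> g \<in> order_auto L"
      using B by (simp add: order_auto_def BijGroup_def compose_Bij compose_eq)
  qed
  then show ?thesis
    unfolding OrderAutoGroup_def by (rule B.subgroup_imp_group)
qed

lemma group_LatAut: "group (LatAut G)"
  unfolding LatAut_def by (rule group_OrderAutoGroup)

lemma (in group) normal_subgroup_lattice_meet: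
  assumes "H \<lhd> G" "K \<lhd> G"
  shows "is_glb (normal_subgroup_lattice G) (H \<inter> K) {H, K}"
proof -
  have "H \<inter> K \<lhd> G"
    using assms by (rule normal_subgroup_intersect)
  then show ?thesis
    using assms by (auto simp: greatest_def Lower_def normal_subgroup_lattice_def)
qed

lemma (in group) normal_subgroup_lattice_join:
  assumes "H \<lhd> G" "K \<lhd> G"
  shows "is_lub (normal_subgroup_lattice G) (H <#> K) {H, K}"
proof -
  interpret H: normal H G by fact
  interpret K: normal K G by fact
  have "H \<subseteq> H <#> K"
  proof
    fix h assume "h \<in> H"
    then have "h = h \<otimes> \<one>" using H.subset by auto
    with \<open>h \<in> H\<close> show "h \<in> H <#> K" unfolding set_mult_def using K.one_closed by blast
  qed
  moreover have "K \<subseteq> H <#> K"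
  proof
    fix k assume "k \<in> K"
    then have "k = \<one> \<otimes> k" using K.subset by auto
    with \<open>k \<in> K\<close> show "k \<in> H <#> K" unfolding set_mult_def using H.one_closed by blast
  qed
  moreover have "H <#> K \<subseteq> M" if "M \<lhd> G" "H \<subseteq> M" "K \<subseteq> M" for M
    using that subgroup.m_closed[OF normal_imp_subgroup[OF that(1)]]
    unfolding set_mult_def by blast
  ultimately show ?thesis
    using assms normal_subgroup_set_mult_closed[OF assms]
    by (auto simp: least_def Upper_def normal_subgroup_lattice_def)
qed

end

theory Submission
  imports Defs
begin

text \<open>Commutators with a single factor \<open>S\<^sub>k\<close> show that a normal subgroup \<open>N\<close> whose projection to that
  factor is nontrivial contains its minimal normal subgroup (\<open>V\<^sub>4\<close> if \<open>k = 4\<close>, otherwise \<open>A\<^sub>k\<close>), and contains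
  \<open>A\<^sub>4\<close> if the projection is not inside \<open>V\<^sub>4\<close>. So \<open>N\<close> is determined by the levels it reaches in the
  factors together with the sign patterns of its elements, a binary linear code \<open>W\<close>.

  An automorphism \<open>\<phi>\<close> of the resulting lattice permutes the atoms, hence the indices, by some \<open>\<sigma>\<close>. The
  elements over a single atom form a chain whose length tells whether \<open>k = 4\<close>, so \<open>\<sigma>\<close> preserves
  the set of indices with \<open>k = 4\<close>. Over \<open>GF(2)\<close> the line spanned by the full vector of a coordinate
  subspace is the only one that is not in a smaller coordinate subspace; therefore \<open>\<phi>\<close> acts on all
  sign patterns by \<open>\<sigma>\<close> and is determined by \<open>\<sigma>\<close>. Conversely every such \<open>\<sigma>\<close> acts on the lattice.\<close>

section \<open>Normal subgroups of the symmetric group\<close>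

text \<open>Source of all conjugating permutations: 3-cycles, and likewise double transpositions,
  are conjugate because their entries can be matched one by one. In the induction step, the
  transposition of \<open>\<sigma> x\<close> and \<open>y\<close> corrects the new entry and fixes
  \<open>ys\<close>, as neither point occurs there.\<close>

lemma exists_permutes_map:
  assumes "length xs = length ys" "distinct xs" "distinct ys" "set xs \<subseteq> S" "set ys \<subseteq> S"
  shows "\<exists>\<sigma>. \<sigma> permutes S \<and> map \<sigma> xs = ys"
  using assms
proof (induction xs ys rule: list_induct2)
  case Nil
  show ?case using permutes_id by (metis list.simps(8))
next
  case (Cons x xs y ys)
  then obtain \<sigma> where \<sigma>: "\<sigma> permutes S" "map \<sigma> xs = ys" by auto
  let ?\<tau> = "transpose (\<sigma> x) y \<circ> \<sigma>"
  have "\<sigma> x \<notin> set ys"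
    using \<sigma> Cons.prems permutes_inj[OF \<sigma>(1)] by (auto dest: injD)
  then have "map (transpose (\<sigma> x) y) ys = ys"
    using Cons.prems by (auto intro!: map_idI simp: transpose_def)
  then have "map ?\<tau> xs = ys"
    using \<sigma>(2) by (metis map_map)
  moreover have "?\<tau> permutes S"
    using \<sigma>(1) Cons.prems by (auto intro!: permutes_compose permutes_swap_id simp: permutes_in_image)
  ultimately have "?\<tau> permutes S \<and> map ?\<tau> (x # xs) = y # ys" by simp
  then show ?case by (intro exI[of _ "?\<tau>"])
qed

lemma conj_transpose:
  assumes "bij g"
  shows "g \<circ> transpose a c \<circ> inv' g = transpose (g a) (g c)"
proof (cases "a = c")
  case True
  then show ?thesis using assms by (simp add: bij_is_surj flip: surj_iff)
next
  case False
  then show ?thesis using conjugation_of_cycle[of "[a, c]" g] assms by simp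
qed

lemma conj_comp:
  assumes "bij g"
  shows "g \<circ> (p \<circ> q) \<circ> inv' g = (g \<circ> p \<circ> inv' g) \<circ> (g \<circ> q \<circ> inv' g)"
  using assms by (simp add: fun_eq_iff bij_is_inj)

section \<open>Normal subgroups of \<open>S_n\<close> forced to be large by commutators\<close>

locale normal_in_sym =
  fixes n :: nat and M
  assumes normal: "M \<lhd> sym_group n"
begin

sublocale normal M "sym_group n" by (rule normal)

lemma comp_M: "p \<in> M \<Longrightarrow> q \<in> M \<Longrightarrow> p \<circ> q \<in> M"
  using subgroup.m_closed[OF normal_imp_subgroup[OF normal], of p q] by (simp add: sym_group_mult)

lemma id_M: "id \<in> M"
  using subgroup.one_closed[OF normal_imp_subgroup[OF normal]] by (simp add: sym_group_one)

lemma inv_M: "p \<in> M \<Longrightarrow> inv' p \<in> M"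
  using m_inv_closed[of p] subset by (metis subsetD sym_group_inv_equality)

lemma conj_M: "\<sigma> permutes {1..n} \<Longrightarrow> p \<in> M \<Longrightarrow> \<sigma> \<circ> p \<circ> inv' \<sigma> \<in> M"
  using inv_op_closed2[of \<sigma> p] by (simp add: sym_group_mult sym_group_carrier)

text \<open>Conjugating one 3-cycle yields all of them, and the 3-cycles generate the alternating
  group.\<close>

lemma alt_group_subset:
  assumes "p \<in> three_cycles n" "p \<in> M"
  shows "carrier (alt_group n) \<subseteq> M"
proof -
  have three: "q \<in> M" if q: "q \<in> three_cycles n" for q
  proof -
    obtain cs ds where cs: "p = cycle_of_list cs" "distinct cs" "length cs = 3" "set cs \<subseteq> {1..n}"
      and ds: "q = cycle_of_list ds" "distinct ds" "length ds = 3" "set ds \<subseteq> {1..n}"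
      using assms(1) q by blast
    then obtain \<sigma> where \<sigma>: "\<sigma> permutes {1..n}" "map \<sigma> cs = ds"
      using exists_permutes_map[of cs ds "{1..n}"] by auto
    then have "q = \<sigma> \<circ> p \<circ> inv' \<sigma>"
      using conjugation_of_cycle[OF cs(2) permutes_bij[OF \<sigma>(1)]] cs(1) ds(1) by simp
    then show ?thesis using conj_M[OF \<sigma>(1) assms(2)] by simp
  qed
  have "q \<in> M" if "q \<in> generate (alt_group n) (three_cycles n)" for q
    using that
  proof induction
    case one
    then show ?case unfolding alt_group_one by (rule id_M)
  next
    case (incl h)
    then show ?case by (rule three)
  next
    case (inv h)
    then show ?case
      using three[OF inv] three_cycles_incl inv_M by (simp add: alt_group_inv_equality subset_iff)
  next
    case (eng h1 h2)
    then show ?case unfolding alt_group_mult by (blast intro: comp_M)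
  qed
  then show ?thesis using alt_group_carrier_as_three_cycles by auto
qed

lemma three_cycle_subset:
  assumes "transpose x y \<circ> transpose y z \<in> M" "distinct [x, y, z]" "{x, y, z} \<subseteq> {1..n}"
  shows "carrier (alt_group n) \<subseteq> M"
proof (rule alt_group_subset)
  show "transpose x y \<circ> transpose y z \<in> three_cycles n"
    using assms(2,3) by (intro CollectI exI[of _ "[x, y, z]"]) auto
qed fact

text \<open>Only the commutators of \<open>g\<close> are known to lie in \<open>M\<close>, not
  \<open>g\<close> itself. In the application \<open>g\<close> is a component of an element of a
  normal subgroup of the product, and \<open>M\<close> is the intersection of that subgroup with the
  factor.\<close>

context
  fixes g
  assumes g: "g permutes {1..n}"
    and comm: "\<forall>h. h permutes {1..n} \<longrightarrow> g \<circ> h \<circ> inv' g \<circ> inv' h \<in> M"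
begin

lemma commutator_transpose:
  assumes "a \<in> {1..n}" "c \<in> {1..n}"
  shows "transpose (g a) (g c) \<circ> transpose a c \<in> M"
  using comm[rule_format, OF permutes_swap_id[OF assms]] conj_transpose[OF permutes_bij[OF g], of a c]
  by simp

lemma g_in: "x \<in> {1..n} \<Longrightarrow> g x \<in> {1..n}"
  using permutes_in_image[OF g] by blast

text \<open>With \<open>c\<close> fixed, the commutator of \<open>g\<close> with
  \<open>transpose a c\<close> is a product of two transpositions sharing the point
  \<open>c\<close>, hence a 3-cycle.\<close>

lemma alt_group_subset_if_fixpoint:
  assumes "a \<in> {1..n}" "c \<in> {1..n}" "g a \<noteq> a" "g c = c"
  shows "carrier (alt_group n) \<subseteq> M"
proof -
  have "g a \<noteq> c" using assms permutes_inj[OF g] by (metis injD)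
  then show ?thesis
    using commutator_transpose[OF assms(1,2)] assms g_in
    by (intro three_cycle_subset[of "g a" c a]) (auto simp: transpose_commute)
qed

text \<open>For the preimage \<open>c\<close> of \<open>a\<close>, the commutator with
  \<open>transpose a c\<close> is a product of two transpositions sharing \<open>a\<close>. It is a
  3-cycle because \<open>c = g a\<close> would give \<open>g (g a) = a\<close>.\<close>

lemma alt_group_subset_if_not_involution:
  assumes "g (g a) \<noteq> a"
  shows "carrier (alt_group n) \<subseteq> M"
proof -
  have a: "a \<in> {1..n}" "g a \<noteq> a" using assms g by (auto simp: permutes_def)
  obtain c where c: "g c = a" using permutes_surj[OF g] by (metis surjD)
  then have "c \<in> {1..n}" using permutes_in_image[OF g] a by metis
  moreover have "c \<noteq> g a" "c \<noteq> a" using assms c a by auto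
  ultimately show ?thesis
    using commutator_transpose[OF a(1), of c] a c g_in
    by (intro three_cycle_subset[of "g a" a c]) auto
qed

text \<open>Take a moved point \<open>a\<close> and a third point \<open>c\<close> outside
  \<open>{a, g a}\<close>. If \<open>g c = c\<close> there is a fixed point, and if
  \<open>g c = a\<close> then \<open>g (g c) = g a\<close> differs from \<open>c\<close>; both cases
  give a 3-cycle. Otherwise \<open>a, g a, c, g c\<close> are distinct and the commutator with
  \<open>transpose a c\<close> is a double transposition.\<close>

lemma alt_group_subset_or_double_transposition:
  assumes "g \<noteq> id" "n \<ge> 3"
  shows "carrier (alt_group n) \<subseteq> M \<or>
    (\<exists>a b c d. distinct [a, b, c, d] \<and> {a, b, c, d} \<subseteq> {1..n} \<and> transpose b d \<circ> transpose a c \<in> M)"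
proof -
  obtain a where a: "g a \<noteq> a" using assms(1) by (metis eq_id_iff)
  then have a1: "a \<in> {1..n}" using g by (auto simp: permutes_def)
  have "card {1..n} > card {a, g a}" using assms(2) by (simp add: card_insert_if)
  then obtain c where c: "c \<in> {1..n}" "c \<noteq> a" "c \<noteq> g a"
    by (metis card_mono finite.emptyI finite.insertI insertCI linorder_not_le subsetI)
  show ?thesis
  proof (cases "g c = c \<or> g c = a")
    case True
    then show ?thesis
      using alt_group_subset_if_fixpoint[OF a1 c(1) a] alt_group_subset_if_not_involution[of c] c
      by metis
  next
    case False
    moreover have "g c \<noteq> g a" using c permutes_inj[OF g] by (metis injD)
    ultimately have "distinct [a, g a, c, g c]" "{a, g a, c, g c} \<subseteq> {1..n}"
      using a a1 c g_in by auto
    with commutator_transpose[OF a1 c(1)] show ?thesis by metis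
  qed
qed

lemma alt_group_subset_if_nontrivial:
  assumes "g \<noteq> id" "n \<ge> 3" "n \<noteq> 4"
  shows "carrier (alt_group n) \<subseteq> M"
  using alt_group_subset_or_double_transposition[OF assms(1,2)]
proof (elim disjE exE conjE)
  fix a b c d
  assume *: "distinct [a, b, c, d]" "{a, b, c, d} \<subseteq> {1..n}" and M: "transpose b d \<circ> transpose a c \<in> M"
  have "card {a, b, c, d} = 4" using * by simp
  then have "card {a, b, c, d} < card {1..n}"
    using * assms(3) card_mono[OF _ *(2)] by simp
  then obtain e where e: "e \<in> {1..n}" "e \<notin> {a, b, c, d}"
    by (metis card_mono finite.emptyI finite.insertI linorder_not_le subsetI)
  \<comment> \<open>A fifth point \<open>e\<close> exists since \<open>n\<close> exceeds 4 once four
    distinct points are present. Conjugation by \<open>transpose d e\<close> replaces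
    \<open>d\<close> by \<open>e\<close>.\<close>
  have "transpose d e \<circ> (transpose b d \<circ> transpose a c) \<circ> inv' (transpose d e) =
      transpose b e \<circ> transpose a c"
    using * e unfolding conj_comp[OF bij_transpose] conj_transpose[OF bij_transpose] by (auto simp: transpose_def)
  then have "transpose b e \<circ> transpose a c \<in> M"
    using conj_M[OF permutes_swap_id M, of d e] e * by auto
  then have "(transpose b d \<circ> transpose a c) \<circ> (transpose b e \<circ> transpose a c) \<in> M"
    by (rule comp_M[OF M])
  \<comment> \<open>The common factor \<open>transpose a c\<close> commutes with
    \<open>transpose b e\<close> and cancels in the product of the two double transpositions,
    leaving a 3-cycle.\<close>
  moreover have "transpose a c \<circ> transpose b e = transpose b e \<circ> transpose a c"
    using * e by (auto simp: fun_eq_iff transpose_def)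
  then have "(transpose b d \<circ> transpose a c) \<circ> (transpose b e \<circ> transpose a c) = transpose d b \<circ> transpose b e"
    by (metis comp_assoc comp_id transpose_comp_involutory transpose_commute)
  ultimately show ?thesis
    using * e by (intro three_cycle_subset[of d b e]) auto
qed

end

end

section \<open>The Klein four-group in \<open>S_4\<close>\<close>

text \<open>Characterised by involutivity and freeness from fixed points instead of a list of
  elements: invariance under conjugation is then immediate, and the work goes into closure under
  products.\<close>

definition klein_four :: "(nat \<Rightarrow> nat) set"
  where "klein_four =
    {p. p permutes {1..4} \<and> (\<forall>x. p (p x) = x) \<and> ((\<exists>x\<in>{1..4}. p x = x) \<longrightarrow> p = id)}"

lemma four_points:
  fixes x :: nat
  assumes "distinct [x, y, u, v]" "{x, y, u, v} \<subseteq> {1..4}"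
  shows "{1..4} = {x, y, u, v}"
  using assms by (intro card_subset_eq[symmetric]) auto

text \<open>A fixed-point-free involution on four points is a pair of 2-element orbits; any
  \<open>u\<close> outside the orbit of \<open>x\<close> lies in the other one.\<close>

lemma klein_four_cases:
  assumes "p \<in> klein_four" "p \<noteq> id" "x \<in> {1..4}" "u \<in> {1..4}" "u \<noteq> x" "u \<noteq> p x"
  shows "distinct [x, p x, u, p u]" "{x, p x, u, p u} \<subseteq> {1..4}"
    "p = transpose x (p x) \<circ> transpose u (p u)"
proof -
  have p: "p permutes {1..4}" "\<And>x. p (p x) = x" "\<And>x. x \<in> {1..4} \<Longrightarrow> p x \<noteq> x"
    using assms(1,2) by (auto simp: klein_four_def)
  have sub: "{x, p x, u, p u} \<subseteq> {1..4}"
    using assms permutes_in_image[OF p(1)] by auto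
  have dist: "distinct [x, p x, u, p u]"
    using assms p by (auto) (metis p(2))+
  show "p = transpose x (p x) \<circ> transpose u (p u)"
  proof
    fix y
    show "p y = (transpose x (p x) \<circ> transpose u (p u)) y"
    proof (cases "y \<in> {1..4}")
      case True
      then have "y \<in> {x, p x, u, p u}" using four_points[OF dist sub] by blast
      then show ?thesis using dist p(2) by (auto simp: transpose_def)
    next
      case False
      then have "p y = y" using p(1) by (auto simp: permutes_def)
      moreover have "y \<notin> {x, p x, u, p u}" using False sub by blast
      ultimately show ?thesis by (auto simp: transpose_def)
    qed
  qed
  show "distinct [x, p x, u, p u]" "{x, p x, u, p u} \<subseteq> {1..4}" by fact+
qed

lemma klein_four_double_transposition:
  assumes "p \<in> klein_four" "p \<noteq> id"
  obtains x y u v where "distinct [x, y, u, v]" "{x, y, u, v} \<subseteq> {1..4}"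
    "p = transpose x y \<circ> transpose u v"
proof -
  have "\<exists>u\<in>{1..4}. u \<noteq> 1 \<and> u \<noteq> p 1"
    by (cases "p 1 = 2") (auto intro: bexI[of _ 2] bexI[of _ 3])
  then obtain u where "u \<in> {1..4}" "u \<noteq> 1" "u \<noteq> p 1" by blast
  with klein_four_cases[OF assms, of 1 u] show thesis by (intro that[of 1 "p 1" u "p u"]) auto
qed

lemma klein_four_subset_alt_group: "klein_four \<subseteq> carrier (alt_group 4)"
proof
  fix p assume p: "p \<in> klein_four"
  have "evenperm p"
  proof (cases "p = id")
    case False
    with p obtain x y u v where "distinct [x, y, u, v]" "p = transpose x y \<circ> transpose u v"
      by (metis klein_four_double_transposition)
    then show ?thesis by (simp add: evenperm_comp permutation_swap_id evenperm_swap)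
  qed simp
  then show "p \<in> carrier (alt_group 4)" using p by (simp add: alt_group_carrier klein_four_def)
qed

text \<open>Two distinct nonidentity elements agree at no point of \<open>{1..4}\<close>. This makes
  them commute and makes their product free of fixed points; commuting involutions have an
  involutive product.\<close>

lemma klein_four_comp:
  assumes p: "p \<in> klein_four" and q: "q \<in> klein_four"
  shows "p \<circ> q \<in> klein_four"
proof (cases "p = id \<or> q = id \<or> p = q")
  case True
  moreover have "p \<circ> p = id" using p by (auto simp: klein_four_def)
  moreover have "id \<in> klein_four" by (simp add: klein_four_def permutes_id)
  ultimately show ?thesis using p q by auto
next
  case False
  have P: "p permutes {1..4}" "\<And>x. p (p x) = x" "\<And>x. x \<in> {1..4} \<Longrightarrow> p x \<noteq> x"
    using p False by (auto simp: klein_four_def)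
  have Q: "q permutes {1..4}" "\<And>x. q (q x) = x" "\<And>x. x \<in> {1..4} \<Longrightarrow> q x \<noteq> x"
    using q False by (auto simp: klein_four_def)
  \<comment> \<open>The image of one point determines the whole involution, since the remaining two
    points must be swapped.\<close>
  have ne: "p x \<noteq> q x" if x: "x \<in> {1..4}" for x
  proof
    assume eq: "p x = q x"
    have "card {x, p x} < card {1..4::nat}" by (simp add: card_insert_if)
    then obtain u where u: "u \<in> {1..4}" "u \<noteq> x" "u \<noteq> p x"
      by (metis card_mono finite.emptyI finite.insertI insertCI linorder_not_le subsetI)
    have P': "distinct [x, p x, u, p u]" "{x, p x, u, p u} \<subseteq> {1..4}"
      "p = transpose x (p x) \<circ> transpose u (p u)"
      using klein_four_cases[OF p _ x u] False by auto
    have Q': "distinct [x, p x, u, q u]" "{x, p x, u, q u} \<subseteq> {1..4}"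
      "q = transpose x (p x) \<circ> transpose u (q u)"
      using klein_four_cases[OF q _ x u(1,2)] False u eq by auto
    have "{x, p x, u, p u} = {x, p x, u, q u}"
      using four_points[OF P'(1,2)] four_points[OF Q'(1,2)] by simp
    then have "p u = q u" using P'(1) Q'(1) by auto
    then show False using P'(3) Q'(3) False by metis
  qed
  \<comment> \<open>Both sides avoid the three distinct points \<open>x\<close>, \<open>p x\<close>,
    \<open>q x\<close>, so both are the fourth point.\<close>
  have comm: "p (q x) = q (p x)" for x
  proof (cases "x \<in> {1..4}")
    case True
    have in4: "p x \<in> {1..4}" "q x \<in> {1..4}" "p (q x) \<in> {1..4}" "q (p x) \<in> {1..4}"
      using True permutes_in_image[OF P(1)] permutes_in_image[OF Q(1)] by auto
    have "p (q x) \<noteq> x" "p (q x) \<noteq> q x" "p (q x) \<noteq> p x" "q (p x) \<noteq> x" "q (p x) \<noteq> q x" "q (p x) \<noteq> p x"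
      using ne[OF True] P(2,3) Q(2,3) True in4 by (metis)+
    moreover have "distinct [x, p x, q x, p (q x)]"
      using calculation ne[OF True] P(3)[OF True] Q(3)[OF True] by auto
    ultimately show ?thesis
      using four_points[of x "p x" "q x" "p (q x)"] True in4 by auto
  next
    case False
    then show ?thesis using P(1) Q(1) by (metis permutes_def)
  qed
  have "p (q x) \<noteq> x" if "x \<in> {1..4}" for x
    using ne[OF that] P(2) by metis
  then show ?thesis
    using permutes_compose[OF Q(1) P(1)] comm P(2) Q(2) by (auto simp: klein_four_def)
qed

lemma klein_four_normal: "klein_four \<lhd> sym_group 4"
proof -
  interpret group "sym_group 4" by (rule sym_group_is_group)
  have inv: "inv' p = p" if "p \<in> klein_four" for p
    using that by (auto simp: klein_four_def intro!: inv_unique_comp)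
  have "subgroup klein_four (sym_group 4)"
  proof (rule subgroupI)
    show "klein_four \<subseteq> carrier (sym_group 4)"
      by (auto simp: klein_four_def sym_group_carrier)
    show "klein_four \<noteq> {}"
      using permutes_id by (auto simp: klein_four_def intro!: exI[of _ id])
    fix p q assume p: "p \<in> klein_four" and q: "q \<in> klein_four"
    have "p \<in> carrier (sym_group 4)" using p by (auto simp: klein_four_def sym_group_carrier)
    then show "inv\<^bsub>sym_group 4\<^esub> p \<in> klein_four" using p inv by simp
    show "p \<otimes>\<^bsub>sym_group 4\<^esub> q \<in> klein_four"
      using klein_four_comp[OF p q] by (simp add: sym_group_mult)
  qed
  moreover have "\<sigma> \<circ> p \<circ> inv' \<sigma> \<in> klein_four"
    if \<sigma>: "\<sigma> permutes {1..4}" and p: "p \<in> klein_four" for \<sigma> p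
  proof -
    have inv: "inv' \<sigma> (\<sigma> x) = x" "\<sigma> (inv' \<sigma> x) = x" for x
      using permutes_inverses[OF \<sigma>] by auto
    have "p = id" if "x \<in> {1..4}" "\<sigma> (p (inv' \<sigma> x)) = x" for x
    proof -
      have "p (inv' \<sigma> x) = inv' \<sigma> x" using that(2) inv by metis
      moreover have "inv' \<sigma> x \<in> {1..4}" using that(1) permutes_in_image[OF permutes_inv[OF \<sigma>]] by blast
      ultimately show ?thesis using p by (auto simp: klein_four_def)
    qed
    moreover have "\<sigma> \<circ> p \<circ> inv' \<sigma> permutes {1..4}"
      using p \<sigma> by (auto simp: klein_four_def intro!: permutes_compose permutes_inv)
    moreover have "(\<sigma> \<circ> p \<circ> inv' \<sigma>) ((\<sigma> \<circ> p \<circ> inv' \<sigma>) x) = x" for x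
      using p inv by (simp add: klein_four_def)
    moreover have "\<sigma> \<circ> id \<circ> inv' \<sigma> = id" using inv by (simp add: fun_eq_iff)
    ultimately show ?thesis unfolding klein_four_def by fastforce
  qed
  ultimately show ?thesis
    by (auto simp: normal_inv_iff sym_group_mult sym_group_carrier simp del: comp_apply)
qed

text \<open>For \<open>n \<ge> 3\<close>, the largest normal subgroup of \<open>S\<^sub>n\<close> properly contained in \<open>A\<^sub>n\<close>.\<close>

definition sym_core :: "nat \<Rightarrow> (nat \<Rightarrow> nat) set"
  where "sym_core n = (if n = 4 then klein_four else {id})"

lemma sym_core_normal: "sym_core n \<lhd> sym_group n"
  using klein_four_normal group.one_is_normal[OF sym_group_is_group[of n]]
  by (auto simp: sym_core_def sym_group_one)

lemma sym_core_subset_alt_group: "sym_core n \<subseteq> carrier (alt_group n)"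
  using klein_four_subset_alt_group permutes_id by (auto simp: sym_core_def alt_group_carrier)

text \<open>A 3-cycle works, because every element of the core squares to the identity.\<close>

lemma ex_alt_group_not_core:
  assumes "n \<ge> 3"
  obtains p where "p \<in> carrier (alt_group n)" "p \<notin> sym_core n"
proof -
  let ?p = "cycle_of_list [1, 2, 3 :: nat]"
  have "?p \<in> three_cycles n" using assms by (intro CollectI exI[of _ "[1, 2, 3]"]) auto
  then have "?p \<in> carrier (alt_group n)" using three_cycles_incl by blast
  moreover have "?p (?p 3) \<noteq> 3" by (simp add: transpose_def)
  then have "?p \<notin> sym_core n"
    unfolding sym_core_def klein_four_def by (metis (mono_tags, lifting) id_apply mem_Collect_eq singletonD)
  ultimately show thesis by (rule that)
qed

lemma ex_klein_four_nontrivial: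
  obtains p where "p \<in> klein_four" "p \<noteq> id"
proof -
  let ?p = "transpose 1 2 \<circ> transpose 3 (4 :: nat)"
  have "?p permutes {1..4}" by (intro permutes_compose permutes_swap_id) auto
  moreover have "?p x \<noteq> x" if "x \<in> {1..4}" for x
    using that by (auto simp: transpose_def)
  moreover have "?p (?p x) = x" for x by (auto simp: transpose_def)
  moreover have "?p 1 \<noteq> 1" by (simp add: transpose_def)
  then have "?p \<noteq> id" by (metis id_apply)
  ultimately show thesis using that[of ?p] by (auto simp: klein_four_def)
qed

context normal_in_sym
begin

text \<open>The dichotomy behind the two levels recorded at each index. Only degree 4 needs care:
  all double transpositions are conjugate, so one of them brings in all of
  \<open>klein_four\<close>, and a permutation outside \<open>klein_four\<close> either is no
  involution or is nontrivial with a fixed point, which already produces a 3-cycle.\<close>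

lemma commutators_subset:
  assumes g: "g permutes {1..n}"
    and comm: "\<forall>h. h permutes {1..n} \<longrightarrow> g \<circ> h \<circ> inv' g \<circ> inv' h \<in> M"
    and n: "n \<ge> 3"
  shows "g \<noteq> id \<Longrightarrow> sym_core n \<subseteq> M"
    and "g \<notin> sym_core n \<Longrightarrow> carrier (alt_group n) \<subseteq> M"
proof -
  show "sym_core n \<subseteq> M" if "g \<noteq> id"
  proof (cases "n = 4")
    case True
    show ?thesis
      using alt_group_subset_or_double_transposition[OF g comm that n]
    proof (elim disjE exE conjE)
      assume "carrier (alt_group n) \<subseteq> M"
      then show ?thesis using sym_core_subset_alt_group by blast
    next
      fix a b c d
      assume *: "distinct [a, b, c, d]" "{a, b, c, d} \<subseteq> {1..n}"
        and M: "transpose b d \<circ> transpose a c \<in> M"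
      have "p \<in> M" if p: "p \<in> klein_four" for p
      proof (cases "p = id")
        case True
        then show ?thesis using id_M by simp
      next
        case False
        with p obtain x y u v where xy: "distinct [x, y, u, v]" "{x, y, u, v} \<subseteq> {1..4}"
          "p = transpose x y \<circ> transpose u v"
          by (metis klein_four_double_transposition)
        obtain \<sigma> where \<sigma>: "\<sigma> permutes {1..n}" "map \<sigma> [b, d, a, c] = [x, y, u, v]"
          using exists_permutes_map[of "[b, d, a, c]" "[x, y, u, v]" "{1..n}"] * xy True \<open>n = 4\<close>
          by auto
        have bij: "bij \<sigma>" using permutes_bij[OF \<sigma>(1)] .
        have "\<sigma> \<circ> (transpose b d \<circ> transpose a c) \<circ> inv' \<sigma> = p"
          using \<sigma>(2) unfolding conj_comp[OF bij] conj_transpose[OF bij] by (simp add: xy(3))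
        then show ?thesis using conj_M[OF \<sigma>(1) M] by simp
      qed
      then show ?thesis using True by (auto simp: sym_core_def)
    qed
  next
    case False
    then show ?thesis using id_M by (simp add: sym_core_def)
  qed
  show "carrier (alt_group n) \<subseteq> M" if nc: "g \<notin> sym_core n"
  proof (cases "n = 4")
    case True
    then consider a where "g (g a) \<noteq> a" | c where "c \<in> {1..n}" "g c = c" "g \<noteq> id"
      using nc g by (auto simp: sym_core_def klein_four_def)
    then show ?thesis
    proof cases
      case 1
      then show ?thesis using alt_group_subset_if_not_involution[OF g comm] by blast
    next
      case 2
      then obtain a where "g a \<noteq> a" by (metis eq_id_iff)
      moreover from this have "a \<in> {1..n}" using g by (auto simp: permutes_def)
      ultimately show ?thesis using alt_group_subset_if_fixpoint[OF g comm, of a c] 2 by blast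
    qed
  next
    case False
    then show ?thesis
      using alt_group_subset_if_nontrivial[OF g comm] nc n by (auto simp: sym_core_def)
  qed
qed

end

section \<open>The lattice of encoded normal subgroups and its automorphisms\<close>

lemma order_autoD:
  assumes "\<phi> \<in> order_auto L"
  shows "bij_betw \<phi> (carrier L) (carrier L)"
    and "x \<in> carrier L \<Longrightarrow> y \<in> carrier L \<Longrightarrow> \<phi> x \<sqsubseteq>\<^bsub>L\<^esub> \<phi> y \<longleftrightarrow> x \<sqsubseteq>\<^bsub>L\<^esub> y"
    and "x \<in> carrier L \<Longrightarrow> \<phi> x \<in> carrier L"
  using assms by (auto simp: order_auto_def Bij_def dest: bij_betwE)

lemma OrderAutoGroup_mult:
  assumes "\<phi> \<in> order_auto L" "\<psi> \<in> order_auto L"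
  shows "\<phi> \<otimes>\<^bsub>OrderAutoGroup L\<^esub> \<psi> = compose (carrier L) \<phi> \<psi>"
  using assms by (simp add: OrderAutoGroup_def BijGroup_def order_auto_def)

lemma carrier_OrderAutoGroup: "carrier (OrderAutoGroup L) = order_auto L"
  by (simp add: OrderAutoGroup_def)

text \<open>An order isomorphism \<open>f\<close> transports automorphisms by conjugation.\<close>

lemma OrderAutoGroup_cong:
  fixes L :: "('a, 'm) gorder_scheme" and L' :: "('b, 'n) gorder_scheme"
  assumes bij: "bij_betw f (carrier L) (carrier L')"
    and le: "\<And>x y. x \<in> carrier L \<Longrightarrow> y \<in> carrier L \<Longrightarrow> f x \<sqsubseteq>\<^bsub>L'\<^esub> f y \<longleftrightarrow> x \<sqsubseteq>\<^bsub>L\<^esub> y"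
  shows "OrderAutoGroup L \<cong> OrderAutoGroup L'"
proof -
  define g where "g = inv_into (carrier L) f"
  have fin: "x \<in> carrier L \<Longrightarrow> f x \<in> carrier L'" for x
    using bij by (auto dest: bij_betwE)
  have gin: "y \<in> carrier L' \<Longrightarrow> g y \<in> carrier L" for y
    using bij_betwE[OF bij_betw_inv_into[OF bij]] by (auto simp: g_def)
  have gf: "x \<in> carrier L \<Longrightarrow> g (f x) = x" for x
    using bij by (auto simp: g_def bij_betw_def)
  have fg: "y \<in> carrier L' \<Longrightarrow> f (g y) = y" for y
    using bij by (auto simp: g_def bij_betw_def f_inv_into_f)
  have le': "x \<in> carrier L' \<Longrightarrow> y \<in> carrier L' \<Longrightarrow> g x \<sqsubseteq>\<^bsub>L\<^esub> g y \<longleftrightarrow> x \<sqsubseteq>\<^bsub>L'\<^esub> y" for x y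
    using le[of "g x" "g y"] gin fg by simp
  have bijg: "bij_betw g (carrier L') (carrier L)"
    unfolding g_def by (rule bij_betw_inv_into[OF bij])
  \<comment> \<open>Conjugation by \<open>f\<close> and its inverse. The restrictions make the
    results extensional, as membership in \<open>Bij\<close> demands.\<close>
  define F where "F = (\<lambda>\<phi>. \<lambda>y\<in>carrier L'. f (\<phi> (g y)))"
  define G where "G = (\<lambda>\<psi>. \<lambda>x\<in>carrier L. g (\<psi> (f x)))"
  have F: "F \<phi> \<in> order_auto L'" if \<phi>: "\<phi> \<in> order_auto L" for \<phi>
  proof -
    note \<phi>D = order_autoD[OF \<phi>]
    have "bij_betw (f \<circ> (\<phi> \<circ> g)) (carrier L') (carrier L')"
      by (intro bij_betw_trans[OF bij_betw_trans[OF bijg \<phi>D(1)] bij])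
    then have "bij_betw (F \<phi>) (carrier L') (carrier L')"
      by (rule iffD1[OF bij_betw_cong, rotated]) (simp add: F_def)
    then show ?thesis
      using \<phi>D(2,3) gin fin le le' by (auto simp: order_auto_def Bij_def F_def)
  qed
  have G: "G \<psi> \<in> order_auto L" if \<psi>: "\<psi> \<in> order_auto L'" for \<psi>
  proof -
    note \<psi>D = order_autoD[OF \<psi>]
    have "bij_betw (g \<circ> (\<psi> \<circ> f)) (carrier L) (carrier L)"
      by (intro bij_betw_trans[OF bij_betw_trans[OF bij \<psi>D(1)] bijg])
    then have "bij_betw (G \<psi>) (carrier L) (carrier L)"
      by (rule iffD1[OF bij_betw_cong, rotated]) (simp add: G_def)
    then show ?thesis
      using \<psi>D(2,3) gin fin le le' by (auto simp: order_auto_def Bij_def G_def)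
  qed
  have ext: "\<phi> \<in> order_auto L \<Longrightarrow> \<phi> \<in> extensional (carrier L)"
    "\<psi> \<in> order_auto L' \<Longrightarrow> \<psi> \<in> extensional (carrier L')" for \<phi> \<psi>
    by (auto simp: order_auto_def Bij_def)
  have GF: "G (F \<phi>) = \<phi>" if "\<phi> \<in> order_auto L" for \<phi>
    by (rule extensionalityI[of _ "carrier L"])
      (use that ext order_autoD(3)[OF that] fin gf in \<open>auto simp: F_def G_def\<close>)
  have FG: "F (G \<psi>) = \<psi>" if "\<psi> \<in> order_auto L'" for \<psi>
    by (rule extensionalityI[of _ "carrier L'"])
      (use that ext order_autoD(3)[OF that] gin fg in \<open>auto simp: F_def G_def\<close>)
  have "F \<in> hom (OrderAutoGroup L) (OrderAutoGroup L')"
  proof (rule homI)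
    fix \<phi> \<psi> assume "\<phi> \<in> carrier (OrderAutoGroup L)" "\<psi> \<in> carrier (OrderAutoGroup L)"
    then have *: "\<phi> \<in> order_auto L" "\<psi> \<in> order_auto L" by (simp_all add: carrier_OrderAutoGroup)
    then show "F (\<phi> \<otimes>\<^bsub>OrderAutoGroup L\<^esub> \<psi>) = F \<phi> \<otimes>\<^bsub>OrderAutoGroup L'\<^esub> F \<psi>"
      using F gin fin gf order_autoD(3)[OF *(1)] order_autoD(3)[OF *(2)]
      by (auto simp: OrderAutoGroup_mult F_def compose_def fun_eq_iff)
  qed (use F in \<open>simp add: carrier_OrderAutoGroup\<close>)
  moreover have "bij_betw F (carrier (OrderAutoGroup L)) (carrier (OrderAutoGroup L'))"
    unfolding carrier_OrderAutoGroup
    by (rule bij_betw_byWitness[where f' = G]) (use F G FG GF in auto)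
  ultimately show ?thesis by (auto simp: is_iso_def iso_def)
qed

text \<open>A normal subgroup of a product of symmetric groups is encoded by the set \<open>Z\<close> of indices at which it
  projects nontrivially, the set \<open>F\<close> of indices whose alternating group it contains, and the set \<open>W\<close>
  of sign patterns of its elements (a subspace of \<open>GF(2)\<^sup>F\<close>, vectors being subsets of \<open>F\<close>). The indices
  with factor \<open>S\<^sub>4\<close> form \<open>Q\<close>: only there can \<open>Z\<close> and \<open>F\<close> differ.\<close>

definition triple_lattice :: "'i set \<Rightarrow> 'i set \<Rightarrow> ('i set \<times> 'i set \<times> 'i set set) gorder"
  where "triple_lattice I Q =
    \<lparr>carrier = {(Z, F, W). F \<subseteq> Z \<and> Z \<subseteq> I \<and> Z - F \<subseteq> Q \<and>
        W \<subseteq> Pow F \<and> {} \<in> W \<and> (\<forall>A\<in>W. \<forall>B\<in>W. sym_diff A B \<in> W)},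
      eq = (=),
      le = \<lambda>(Z, F, W) (Z', F', W'). Z \<subseteq> Z' \<and> F \<subseteq> F' \<and> W \<subseteq> W'\<rparr>"

lemma le_triple_lattice [simp]:
  "(Z, F, W) \<sqsubseteq>\<^bsub>triple_lattice I Q\<^esub> (Z', F', W') \<longleftrightarrow> Z \<subseteq> Z' \<and> F \<subseteq> F' \<and> W \<subseteq> W'"
  by (simp add: triple_lattice_def)

lemma triple_in_carrier:
  "(Z, F, W) \<in> carrier (triple_lattice I Q) \<longleftrightarrow> F \<subseteq> Z \<and> Z \<subseteq> I \<and> Z - F \<subseteq> Q \<and>
    W \<subseteq> Pow F \<and> {} \<in> W \<and> (\<forall>A\<in>W. \<forall>B\<in>W. sym_diff A B \<in> W)"
  by (simp add: triple_lattice_def)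

section \<open>Action of index permutations on the triples\<close>

definition triple_map :: "('i \<Rightarrow> 'j) \<Rightarrow> 'i set \<times> 'i set \<times> 'i set set \<Rightarrow> 'j set \<times> 'j set \<times> 'j set set"
  where "triple_map \<sigma> = (\<lambda>(Z, F, W). (\<sigma> ` Z, \<sigma> ` F, (`) \<sigma> ` W))"

lemma triple_map_comp: "triple_map \<sigma> (triple_map \<tau> t) = triple_map (\<sigma> \<circ> \<tau>) t"
  by (auto simp: triple_map_def image_image image_comp split: prod.splits)

lemma triple_map_id: "triple_map id t = t"
  by (simp add: triple_map_def split: prod.splits)

lemma triple_map_in_carrier:
  assumes \<sigma>: "\<sigma> permutes I" "\<sigma> ` Q = Q" and t: "t \<in> carrier (triple_lattice I Q)"
  shows "triple_map \<sigma> t \<in> carrier (triple_lattice I Q)"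
proof -
  obtain Z F W where t': "t = (Z, F, W)" by (metis prod_cases3)
  have inj: "inj \<sigma>" using \<sigma>(1) by (rule permutes_inj)
  have sd: "sym_diff (\<sigma> ` A) (\<sigma> ` B) = \<sigma> ` sym_diff A B" for A B
    by (simp add: image_Un image_set_diff[OF inj])
  have "\<sigma> ` Z - \<sigma> ` F \<subseteq> Q" if "Z - F \<subseteq> Q"
    using \<sigma>(2) that by (metis image_mono image_set_diff inj)
  moreover have "\<sigma> ` Z \<subseteq> I" if "Z \<subseteq> I"
    using permutes_image[OF \<sigma>(1)] that by blast
  moreover have "{} \<in> (`) \<sigma> ` W" if "{} \<in> W" using that by force
  moreover have "(`) \<sigma> ` W \<subseteq> Pow (\<sigma> ` F)" if "W \<subseteq> Pow F" using that by blast
  moreover have "\<forall>A\<in>(`) \<sigma> ` W. \<forall>B\<in>(`) \<sigma> ` W. sym_diff A B \<in> (`) \<sigma> ` W"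
    if "\<forall>A\<in>W. \<forall>B\<in>W. sym_diff A B \<in> W"
    using that by (simp only: ball_simps sd) blast
  ultimately show ?thesis
    using t unfolding t' triple_map_def prod.case triple_in_carrier by (simp add: image_mono)
qed

lemma triple_map_le:
  assumes "inj \<sigma>"
  shows "triple_map \<sigma> s \<sqsubseteq>\<^bsub>triple_lattice I Q\<^esub> triple_map \<sigma> t \<longleftrightarrow> s \<sqsubseteq>\<^bsub>triple_lattice I Q\<^esub> t"
proof -
  have "inj ((`) \<sigma>)" using assms by (simp add: inj_image_eq_iff inj_def)
  then show ?thesis
    using assms by (cases s; cases t) (simp add: triple_map_def inj_image_subset_iff)
qed

lemma triple_map_order_auto:
  assumes \<sigma>: "\<sigma> permutes I" "\<sigma> ` Q = Q"
  shows "restrict (triple_map \<sigma>) (carrier (triple_lattice I Q)) \<in> order_auto (triple_lattice I Q)"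
    (is "restrict _ ?T \<in> _")
proof -
  have inv: "inv' \<sigma> permutes I" "inv' \<sigma> ` Q = Q"
    using permutes_inv[OF \<sigma>(1)] image_inv_f_f[OF permutes_inj[OF \<sigma>(1)], of Q] \<sigma>(2) by simp_all
  have "bij_betw (triple_map \<sigma>) ?T ?T"
    by (rule bij_betw_byWitness[where f' = "triple_map (inv' \<sigma>)"])
      (use triple_map_in_carrier[OF \<sigma>] triple_map_in_carrier[OF inv] in
        \<open>auto simp: triple_map_comp permutes_inv_o[OF \<sigma>(1)] triple_map_id\<close>)
  then show ?thesis
    using triple_map_le[OF permutes_inj[OF \<sigma>(1)]]
    by (auto simp: order_auto_def Bij_def)
qed

section \<open>Every automorphism of the triple lattice comes from an index permutation\<close>

locale triple_lattice_auto =
  fixes I Q :: "'i set" and \<phi>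
  assumes fin: "finite I" and Q: "Q \<subseteq> I" and \<phi>: "\<phi> \<in> order_auto (triple_lattice I Q)"
begin

abbreviation "T \<equiv> carrier (triple_lattice I Q)"

abbreviation le_T (infix "\<preceq>" 50) where "s \<preceq> t \<equiv> s \<sqsubseteq>\<^bsub>triple_lattice I Q\<^esub> t"

text \<open>Encodes the minimal normal subgroup inside factor \<open>i\<close>: the Klein four-group
  for \<open>i\<close> in \<open>Q\<close>, otherwise the alternating group.\<close>

definition atom :: "'i \<Rightarrow> 'i set \<times> 'i set \<times> 'i set set"
  where "atom i = ({i}, {i} - Q, {{}})"

text \<open>Encodes the product of the alternating groups over \<open>J\<close>.\<close>

definition bottom_on :: "'i set \<Rightarrow> 'i set \<times> 'i set \<times> 'i set set"
  where "bottom_on J = (J, J, {{}})"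

text \<open>Encodes the elements supported on \<open>J\<close> whose components are all even or all
  odd; the code is spanned by the full vector of \<open>J\<close>.\<close>

definition diag :: "'i set \<Rightarrow> 'i set \<times> 'i set \<times> 'i set set"
  where "diag J = (J, J, {{}, J})"

lemma atom_in: "i \<in> I \<Longrightarrow> atom i \<in> T"
  by (auto simp: atom_def triple_in_carrier)

lemma bottom_on_in: "J \<subseteq> I \<Longrightarrow> bottom_on J \<in> T"
  by (auto simp: bottom_on_def triple_in_carrier)

lemma diag_in: "J \<subseteq> I \<Longrightarrow> diag J \<in> T"
  by (auto simp: diag_def triple_in_carrier)

text \<open>The three families of test elements read off the three components of a triple, so
  \<open>\<phi>\<close> is determined by its values on them. For \<open>atom\<close>, the carrier
  condition \<open>Z - F \<subseteq> Q\<close> supplies the inclusion in the second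
  component.\<close>

lemma atom_le: "t \<in> T \<Longrightarrow> atom i \<preceq> t \<longleftrightarrow> i \<in> fst t"
  by (cases t) (auto simp: atom_def triple_in_carrier)

lemma bottom_on_le: "t \<in> T \<Longrightarrow> bottom_on J \<preceq> t \<longleftrightarrow> J \<subseteq> fst (snd t)"
  by (cases t) (auto simp: bottom_on_def triple_in_carrier)

lemma diag_le: "t \<in> T \<Longrightarrow> diag J \<preceq> t \<longleftrightarrow> J \<in> snd (snd t)"
  by (cases t) (force simp: diag_def triple_in_carrier)

lemma le_antisym_T: "s \<preceq> t \<Longrightarrow> t \<preceq> s \<Longrightarrow> s = t"
  by (cases s; cases t) auto

lemma fst_subset: "t \<in> T \<Longrightarrow> fst t \<subseteq> I"
  by (cases t) (auto simp: triple_in_carrier)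

lemma bottom_le: "t \<in> T \<Longrightarrow> bottom_on {} \<preceq> t"
  by (simp add: bottom_on_le)

lemma eq_bottom: "t \<in> T \<Longrightarrow> fst t = {} \<Longrightarrow> t = bottom_on {}"
  by (cases t) (auto simp: triple_in_carrier bottom_on_def)

lemma \<phi>_in: "t \<in> T \<Longrightarrow> \<phi> t \<in> T"
  by (rule order_autoD(3)[OF \<phi>])

lemma \<phi>_le: "s \<in> T \<Longrightarrow> t \<in> T \<Longrightarrow> \<phi> s \<preceq> \<phi> t \<longleftrightarrow> s \<preceq> t"
  by (rule order_autoD(2)[OF \<phi>])

lemma \<phi>_eq: "s \<in> T \<Longrightarrow> t \<in> T \<Longrightarrow> \<phi> s = \<phi> t \<longleftrightarrow> s = t"
  using order_autoD(1)[OF \<phi>] by (auto simp: bij_betw_def inj_on_def)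

lemma \<phi>_surj: "t \<in> T \<Longrightarrow> \<exists>s\<in>T. \<phi> s = t"
  using order_autoD(1)[OF \<phi>] unfolding bij_betw_def by (metis imageE)

lemma \<phi>_bottom: "\<phi> (bottom_on {}) = bottom_on {}"
proof -
  obtain s where "s \<in> T" "\<phi> s = bottom_on {}"
    using \<phi>_surj[OF bottom_on_in] by blast
  then show ?thesis
    by (metis bottom_le bottom_on_in empty_subsetI le_antisym_T \<phi>_in \<phi>_le)
qed

text \<open>The image is not the bottom, so some \<open>atom j\<close> lies below it. The preimage
  of \<open>atom j\<close> is a nonbottom element below \<open>atom i\<close>, hence equal to
  \<open>atom i\<close>.\<close>

lemma \<phi>_atom:
  assumes i: "i \<in> I"
  shows "\<exists>j\<in>I. \<phi> (atom i) = atom j"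
proof -
  have a: "atom i \<in> T" using i by (rule atom_in)
  have "atom i \<noteq> bottom_on {}" by (simp add: atom_def bottom_on_def)
  then have "\<phi> (atom i) \<noteq> bottom_on {}"
    using \<phi>_eq[OF a bottom_on_in[OF empty_subsetI]] \<phi>_bottom by simp
  then obtain j where j: "j \<in> fst (\<phi> (atom i))" using eq_bottom[OF \<phi>_in[OF a]] by blast
  then have jI: "j \<in> I" using fst_subset[OF \<phi>_in[OF a]] by blast
  have ja: "atom j \<preceq> \<phi> (atom i)" using j atom_le[OF \<phi>_in[OF a]] by simp
  obtain s where s: "s \<in> T" "\<phi> s = atom j" using \<phi>_surj[OF atom_in[OF jI]] by blast
  have sa: "s \<preceq> atom i" using ja s \<phi>_le[OF s(1) a] by simp
  have "s \<noteq> bottom_on {}" using s(2) \<phi>_bottom by (auto simp: atom_def bottom_on_def)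
  then obtain k where "k \<in> fst s" using eq_bottom[OF s(1)] by blast
  moreover have "fst s \<subseteq> {i}" using sa by (cases s) (simp add: atom_def)
  ultimately have "atom i \<preceq> s" using atom_le[OF s(1)] by blast
  then have "s = atom i" using sa le_antisym_T by blast
  then show ?thesis using s jI by blast
qed

text \<open>The index chosen is unique, since \<open>atom j\<close> determines \<open>j\<close>. The
  identity outside \<open>I\<close> is the default that \<open>permutes\<close> requires.\<close>

definition "\<sigma> i = (if i \<in> I then SOME j. j \<in> I \<and> \<phi> (atom i) = atom j else i)"

lemma \<sigma>: "i \<in> I \<Longrightarrow> \<sigma> i \<in> I \<and> \<phi> (atom i) = atom (\<sigma> i)"
  using someI_ex[of "\<lambda>j. j \<in> I \<and> \<phi> (atom i) = atom j"] \<phi>_atom by (auto simp: \<sigma>_def)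

lemma \<sigma>_permutes: "\<sigma> permutes I"
proof (rule bij_imp_permutes)
  have "inj_on \<sigma> I"
  proof (rule inj_onI)
    fix i j assume ij: "i \<in> I" "j \<in> I" "\<sigma> i = \<sigma> j"
    then have "atom i = atom j" using \<sigma> \<phi>_eq[OF atom_in atom_in] by metis
    then show "i = j" by (simp add: atom_def)
  qed
  moreover have "\<sigma> ` I \<subseteq> I" using \<sigma> by blast
  ultimately show "bij_betw \<sigma> I I" using endo_inj_surj[OF fin] by (simp add: bij_betw_def)
qed (simp add: \<sigma>_def)

lemma inj_\<sigma>: "inj \<sigma>"
  by (rule permutes_inj[OF \<sigma>_permutes])

lemma eq_\<sigma>_image:
  assumes "A \<subseteq> I" "B \<subseteq> I" "\<And>i. i \<in> I \<Longrightarrow> \<sigma> i \<in> A \<longleftrightarrow> i \<in> B"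
  shows "A = \<sigma> ` B"
proof -
  have "A \<subseteq> \<sigma> ` I" using assms(1) permutes_image[OF \<sigma>_permutes] by simp
  then show ?thesis using assms by blast
qed

lemma fst_\<phi>:
  assumes t: "t \<in> T"
  shows "fst (\<phi> t) = \<sigma> ` fst t"
proof (rule eq_\<sigma>_image)
  fix i assume i: "i \<in> I"
  show "\<sigma> i \<in> fst (\<phi> t) \<longleftrightarrow> i \<in> fst t"
    using \<phi>_le[OF atom_in[OF i] t] \<sigma>[OF i] by (simp add: atom_le t \<phi>_in)
qed (use t \<phi>_in fst_subset in auto)

text \<open>In group terms: the nontrivial normal subgroups inside one factor are
  \<open>V_4\<close>, \<open>A_4\<close>, \<open>S_4\<close> for degree 4, and \<open>A_k\<close>,
  \<open>S_k\<close> otherwise.\<close>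

lemma over_single_atom:
  assumes "t \<in> T" "fst t = {i}"
  shows "t = atom i \<and> i \<in> Q \<or> t = bottom_on {i} \<or> t = diag {i}"
proof -
  obtain F W where t: "t = ({i}, F, W)" using assms(2) by (cases t) auto
  show ?thesis
  proof (cases "F = {}")
    case True
    then show ?thesis using assms(1) by (auto simp: t triple_in_carrier atom_def)
  next
    case False
    then have F: "F = {i}" using assms(1) by (auto simp: t triple_in_carrier)
    then have "W \<subseteq> {{}, {i}}" "{} \<in> W" using assms(1) by (auto simp: t triple_in_carrier)
    then have "W = {{}} \<or> W = {{}, {i}}" by blast
    then show ?thesis by (auto simp: t F bottom_on_def diag_def)
  qed
qed

text \<open>For \<open>i\<close> in \<open>Q\<close> there are three distinct elements over
  \<open>i\<close>, and their images are three distinct elements over \<open>\<sigma> i\<close>,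
  which only happens over an index of \<open>Q\<close>. The order then sends the middle of one chain
  to the middle of the other.\<close>

lemma \<phi>_bottom_on_in_Q:
  assumes i: "i \<in> Q"
  shows "\<sigma> i \<in> Q" "\<phi> (bottom_on {i}) = bottom_on {\<sigma> i}"
proof -
  have iI: "i \<in> I" using i Q by blast
  have in_T: "atom i \<in> T" "bottom_on {i} \<in> T" "diag {i} \<in> T"
    using iI by (auto intro: atom_in bottom_on_in diag_in)
  have ne: "atom i \<noteq> bottom_on {i}" "bottom_on {i} \<noteq> diag {i}" "atom i \<noteq> diag {i}"
    using i by (auto simp: atom_def bottom_on_def diag_def)
  have "bottom_on {i} \<preceq> diag {i}" by (auto simp: bottom_on_def diag_def)
  then have le: "\<phi> (bottom_on {i}) \<preceq> \<phi> (diag {i})" using in_T \<phi>_le by simp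
  have ne': "atom (\<sigma> i) \<noteq> \<phi> (bottom_on {i})" "\<phi> (bottom_on {i}) \<noteq> \<phi> (diag {i})" "atom (\<sigma> i) \<noteq> \<phi> (diag {i})"
    using ne in_T \<phi>_eq \<sigma>[OF iI] by metis+
  have "fst (\<phi> (bottom_on {i})) = {\<sigma> i}" "fst (\<phi> (diag {i})) = {\<sigma> i}"
    using in_T by (auto simp: fst_\<phi> bottom_on_def diag_def)
  then have *: "\<phi> (bottom_on {i}) = bottom_on {\<sigma> i} \<or> \<phi> (bottom_on {i}) = diag {\<sigma> i}"
    "\<phi> (diag {i}) = bottom_on {\<sigma> i} \<or> \<phi> (diag {i}) = diag {\<sigma> i}"
    using over_single_atom in_T \<phi>_in ne' by metis+
  have "\<not> diag {\<sigma> i} \<preceq> bottom_on {\<sigma> i}" by (auto simp: bottom_on_def diag_def)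
  then show b: "\<phi> (bottom_on {i}) = bottom_on {\<sigma> i}" using * le ne' by metis
  show "\<sigma> i \<in> Q" using ne'(1) b by (auto simp: atom_def bottom_on_def)
qed

lemma \<sigma>_Q: "\<sigma> ` Q = Q"
  by (rule endo_inj_surj) (use \<phi>_bottom_on_in_Q fin Q inj_\<sigma> in \<open>auto intro: finite_subset inj_on_subset\<close>)

lemma \<phi>_bottom_on:
  assumes i: "i \<in> I"
  shows "\<phi> (bottom_on {i}) = bottom_on {\<sigma> i}"
proof (cases "i \<in> Q")
  case True
  then show ?thesis by (rule \<phi>_bottom_on_in_Q)
next
  case False
  then have "\<sigma> i \<notin> Q" using \<sigma>_Q inj_\<sigma> by (metis inj_image_mem_iff)
  then have "bottom_on {i} = atom i" "bottom_on {\<sigma> i} = atom (\<sigma> i)"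
    using False by (auto simp: bottom_on_def atom_def)
  then show ?thesis using \<sigma>[OF i] by simp
qed

lemma fst_snd_\<phi>:
  assumes t: "t \<in> T"
  shows "fst (snd (\<phi> t)) = \<sigma> ` fst (snd t)"
proof (rule eq_\<sigma>_image)
  fix i assume i: "i \<in> I"
  have "bottom_on {\<sigma> i} \<preceq> \<phi> t \<longleftrightarrow> bottom_on {i} \<preceq> t"
    using \<phi>_le[OF bottom_on_in t, of "{i}"] \<phi>_bottom_on[OF i] i by simp
  then show "\<sigma> i \<in> fst (snd (\<phi> t)) \<longleftrightarrow> i \<in> fst (snd t)"
    by (simp add: bottom_on_le t \<phi>_in)
next
  have "s \<in> T \<Longrightarrow> fst (snd s) \<subseteq> I" for s by (cases s) (auto simp: triple_in_carrier)
  then show "fst (snd (\<phi> t)) \<subseteq> I" "fst (snd t) \<subseteq> I" using t \<phi>_in by auto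
qed

text \<open>By induction, \<open>\<phi> (diag J)\<close> contains no diagonal over a nonempty proper subset of \<open>\<sigma> ` J\<close>, which
  leaves only \<open>diag (\<sigma> ` J)\<close> and \<open>bottom_on (\<sigma> ` J)\<close>; the latter already lies below \<open>\<phi> (bottom_on J)\<close>.\<close>

lemma \<phi>_diag: "J \<subseteq> I \<Longrightarrow> \<phi> (diag J) = diag (\<sigma> ` J)"
proof (induction "card J" arbitrary: J rule: less_induct)
  case less
  have d: "diag J \<in> T" and b: "bottom_on J \<in> T"
    using less.prems by (auto intro: diag_in bottom_on_in)
  obtain W where W: "\<phi> (diag J) = (\<sigma> ` J, \<sigma> ` J, W)"
    using fst_\<phi>[OF d] fst_snd_\<phi>[OF d] by (cases "\<phi> (diag J)") (simp add: diag_def)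
  then have W': "W \<subseteq> Pow (\<sigma> ` J)" "{} \<in> W" using \<phi>_in[OF d] by (auto simp: triple_in_carrier)
  have sub: "W \<subseteq> {{}, \<sigma> ` J}"
  proof
    fix K assume K: "K \<in> W"
    then obtain J' where J': "J' \<subseteq> J" "K = \<sigma> ` J'" using W'(1) by (metis PowD subsetD subset_imageE)
    show "K \<in> {{}, \<sigma> ` J}"
    proof (cases "J' = J")
      case False
      then have "card J' < card J"
        using J' less.prems fin by (metis finite_subset psubsetI psubset_card_mono)
      then have "\<phi> (diag J') = diag K" using less.hyps J' less.prems by blast
      moreover have "diag K \<preceq> \<phi> (diag J)" using K diag_le[OF \<phi>_in[OF d]] W by simp
      moreover have "diag J' \<in> T" using J' less.prems by (intro diag_in) blast
      ultimately have "diag J' \<preceq> diag J" using \<phi>_le[OF _ d] by metis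
      then have "J' \<in> {{}, J}" using diag_le[OF d] by (simp add: diag_def)
      then show ?thesis using J' by blast
    qed (use J' in simp)
  qed
  have "\<sigma> ` J \<in> W"
  proof (rule ccontr)
    assume n: "\<sigma> ` J \<notin> W"
    then have "W = {{}}" using sub W' by blast
    moreover obtain V where "\<phi> (bottom_on J) = (\<sigma> ` J, \<sigma> ` J, V)"
      using fst_\<phi>[OF b] fst_snd_\<phi>[OF b] by (cases "\<phi> (bottom_on J)") (simp add: bottom_on_def)
    moreover from this have "{} \<in> V" using \<phi>_in[OF b] by (simp add: triple_in_carrier)
    ultimately have "\<phi> (diag J) \<preceq> \<phi> (bottom_on J)" using W by simp
    then have "diag J \<preceq> bottom_on J" using \<phi>_le d b by blast
    then have "J = {}" by (simp add: diag_def bottom_on_def)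
    then show False using n W' by simp
  qed
  then have "W = {{}, \<sigma> ` J}" using sub W' by blast
  then show ?case using W by (simp add: diag_def)
qed

lemma snd_snd_\<phi>:
  assumes t: "t \<in> T"
  shows "snd (snd (\<phi> t)) = (`) \<sigma> ` snd (snd t)"
proof -
  have sub: "s \<in> T \<Longrightarrow> K \<in> snd (snd s) \<Longrightarrow> K \<subseteq> I" for s K
    by (cases s) (force simp: triple_in_carrier)
  have iff: "\<sigma> ` J \<in> snd (snd (\<phi> t)) \<longleftrightarrow> J \<in> snd (snd t)" if "J \<subseteq> I" for J
    using \<phi>_le[OF diag_in[OF that] t] \<phi>_diag[OF that] by (simp add: diag_le t \<phi>_in)
  show ?thesis
  proof (intro equalityI subsetI)
    fix K assume K: "K \<in> snd (snd (\<phi> t))"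
    then have "K \<subseteq> \<sigma> ` I" using sub[OF \<phi>_in[OF t]] permutes_image[OF \<sigma>_permutes] by blast
    then obtain J where "J \<subseteq> I" "K = \<sigma> ` J" by (metis subset_imageE)
    then show "K \<in> (`) \<sigma> ` snd (snd t)" using iff K by blast
  qed (use sub[OF t] iff in blast)
qed

lemma \<phi>_eq_triple_map: "\<phi> = restrict (triple_map \<sigma>) T"
proof (rule extensionalityI[of _ T])
  show "\<phi> \<in> extensional T" using \<phi> by (auto simp: order_auto_def Bij_def)
  fix t assume t: "t \<in> T"
  show "\<phi> t = restrict (triple_map \<sigma>) T t"
    using t fst_\<phi>[OF t] fst_snd_\<phi>[OF t] snd_snd_\<phi>[OF t]
    by (cases t; cases "\<phi> t") (simp add: triple_map_def)
qed simp

end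

text \<open>By injectivity a permutation preserving \<open>Inl\<close> A\<open>also keeps\<close>Inr
  \<open>B\<close> apart from it, so it acts separately on the summands. This turns the stabiliser
  of \<open>Q\<close> into a direct product of two symmetric groups.\<close>

lemma permutes_Plus_imp_map_sum:
  assumes fin: "finite A" "finite B"
    and \<sigma>: "\<sigma> permutes Sum_Type.Plus A B" "\<sigma> ` Inl ` A = Inl ` A"
  obtains \<pi> \<rho> where "\<pi> permutes A" "\<rho> permutes B" "\<sigma> = map_sum \<pi> \<rho>"
proof -
  have inj: "inj \<sigma>" using \<sigma>(1) by (rule permutes_inj)
  have l: "\<exists>y. \<sigma> (Inl x) = Inl y \<and> (x \<in> A \<longrightarrow> y \<in> A) \<and> (x \<notin> A \<longrightarrow> y = x)" for x
  proof (cases "x \<in> A")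
    case True
    then have "\<sigma> (Inl x) \<in> Inl ` A" using \<sigma>(2) by blast
    then show ?thesis using True by auto
  next
    case False
    then have "\<sigma> (Inl x) = Inl x" using \<sigma>(1) by (auto simp: permutes_def)
    then show ?thesis using False by auto
  qed
  have r: "\<exists>y. \<sigma> (Inr x) = Inr y \<and> (x \<in> B \<longrightarrow> y \<in> B) \<and> (x \<notin> B \<longrightarrow> y = x)" for x
  proof (cases "x \<in> B")
    case True
    then have "\<sigma> (Inr x) \<in> Sum_Type.Plus A B" using permutes_in_image[OF \<sigma>(1)] by blast
    moreover have "\<sigma> (Inr x) \<notin> Inl ` A" using \<sigma>(2) inj by (metis inj_image_mem_iff Inl_Inr_False imageE)
    ultimately show ?thesis using True by auto
  next
    case False
    then have "\<sigma> (Inr x) = Inr x" using \<sigma>(1) by (auto simp: permutes_def)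
    then show ?thesis using False by auto
  qed
  obtain \<pi> where \<pi>: "\<And>x. \<sigma> (Inl x) = Inl (\<pi> x)" "\<And>x. x \<in> A \<Longrightarrow> \<pi> x \<in> A" "\<And>x. x \<notin> A \<Longrightarrow> \<pi> x = x"
    using l by metis
  obtain \<rho> where \<rho>: "\<And>x. \<sigma> (Inr x) = Inr (\<rho> x)" "\<And>x. x \<in> B \<Longrightarrow> \<rho> x \<in> B" "\<And>x. x \<notin> B \<Longrightarrow> \<rho> x = x"
    using r by metis
  have "inj_on \<pi> A" by (rule inj_onI) (metis \<pi>(1) inj injD Inl_inject)
  then have "\<pi> permutes A"
    using endo_inj_surj[OF fin(1), of \<pi>] \<pi> by (intro bij_imp_permutes) (auto simp: bij_betw_def)
  moreover have "inj_on \<rho> B" by (rule inj_onI) (metis \<rho>(1) inj injD Inr_inject)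
  then have "\<rho> permutes B"
    using endo_inj_surj[OF fin(2), of \<rho>] \<rho> by (intro bij_imp_permutes) (auto simp: bij_betw_def)
  moreover have "\<sigma> = map_sum \<pi> \<rho>"
  proof
    show "\<sigma> x = map_sum \<pi> \<rho> x" for x by (cases x) (simp_all add: \<pi> \<rho>)
  qed
  ultimately show thesis by (rule that)
qed

lemma map_sum_permutes:
  assumes "\<pi> permutes A" "\<rho> permutes B"
  shows "map_sum \<pi> \<rho> permutes Sum_Type.Plus A B" "map_sum \<pi> \<rho> ` Inl ` A = Inl ` A"
proof -
  show img: "map_sum \<pi> \<rho> ` Inl ` A = Inl ` A"
    using permutes_image[OF assms(1)] by (simp add: image_image) (metis image_image)
  have "map_sum \<pi> \<rho> ` Inr ` B = Inr ` B"
    using permutes_image[OF assms(2)] by (simp add: image_image) (metis image_image)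
  with img have "map_sum \<pi> \<rho> ` (Sum_Type.Plus A B) = Sum_Type.Plus A B" by (simp add: Sum_Type.Plus_def image_Un)
  moreover have "inj_on (map_sum \<pi> \<rho>) (Sum_Type.Plus A B)"
    using sum.inj_map permutes_inj[OF assms(1)] permutes_inj[OF assms(2)] inj_on_subset by blast
  moreover have "map_sum \<pi> \<rho> x = x" if "x \<notin> Sum_Type.Plus A B" for x
    using that assms by (cases x) (auto simp: permutes_def)
  ultimately show "map_sum \<pi> \<rho> permutes Sum_Type.Plus A B"
    by (intro bij_imp_permutes) (auto simp: bij_betw_def)
qed

lemma OrderAutoGroup_triple_lattice:
  "OrderAutoGroup (triple_lattice (Sum_Type.Plus {1..p} {1..q}) (Inl ` {1..p})) \<cong> sym_group p \<times>\<times> sym_group q"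
    (is "OrderAutoGroup ?L \<cong> _")
proof -
  let ?I = "Sum_Type.Plus {1..p} {1..q}" and ?Q = "Inl ` {1..p} :: (nat + nat) set"
  define f where "f = (\<lambda>(\<pi> :: nat \<Rightarrow> nat, \<rho> :: nat \<Rightarrow> nat). restrict (triple_map (map_sum \<pi> \<rho>)) (carrier ?L))"
  have carr: "(\<pi>, \<rho>) \<in> carrier (sym_group p \<times>\<times> sym_group q) \<longleftrightarrow>
      \<pi> permutes {1..p} \<and> \<rho> permutes {1..q}" for \<pi> \<rho>
    by (simp add: sym_group_carrier)
  have f_in: "f (\<pi>, \<rho>) \<in> order_auto ?L" if "\<pi> permutes {1..p}" "\<rho> permutes {1..q}" for \<pi> \<rho>
    unfolding f_def prod.case by (intro triple_map_order_auto map_sum_permutes[OF that])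
  have "f \<in> hom (sym_group p \<times>\<times> sym_group q) (OrderAutoGroup ?L)"
  proof (rule homI)
    fix x assume "x \<in> carrier (sym_group p \<times>\<times> sym_group q)"
    then show "f x \<in> carrier (OrderAutoGroup ?L)"
      by (cases x) (simp only: carr carrier_OrderAutoGroup f_in)
  next
    fix x y assume xy: "x \<in> carrier (sym_group p \<times>\<times> sym_group q)"
      "y \<in> carrier (sym_group p \<times>\<times> sym_group q)"
    obtain \<pi> \<rho> \<pi>' \<rho>' where eq: "x = (\<pi>, \<rho>)" "y = (\<pi>', \<rho>')" by (cases x; cases y) auto
    have *: "\<pi> permutes {1..p}" "\<rho> permutes {1..q}" "\<pi>' permutes {1..p}" "\<rho>' permutes {1..q}"
      using xy unfolding eq carr by auto
    show "f (x \<otimes>\<^bsub>sym_group p \<times>\<times> sym_group q\<^esub> y) = f x \<otimes>\<^bsub>OrderAutoGroup ?L\<^esub> f y"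
      unfolding eq OrderAutoGroup_mult[OF f_in[OF *(1,2)] f_in[OF *(3,4)]]
      using triple_map_in_carrier[OF map_sum_permutes[OF *(3,4)]]
      by (auto simp: f_def compose_def fun_eq_iff sym_group_mult triple_map_comp map_sum.comp)
  qed
  moreover have "inj_on f (carrier (sym_group p \<times>\<times> sym_group q))"
  proof (rule inj_onI)
    fix x y assume xy: "x \<in> carrier (sym_group p \<times>\<times> sym_group q)"
      "y \<in> carrier (sym_group p \<times>\<times> sym_group q)" and fxy: "f x = f y"
    obtain \<pi> \<rho> \<pi>' \<rho>' where eq: "x = (\<pi>, \<rho>)" "y = (\<pi>', \<rho>')" by (cases x; cases y) auto
    have *: "\<pi> permutes {1..p}" "\<rho> permutes {1..q}" "\<pi>' permutes {1..p}" "\<rho>' permutes {1..q}"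
      using xy unfolding eq carr by auto
    have "map_sum \<pi> \<rho> i = map_sum \<pi>' \<rho>' i" for i
    proof (cases "i \<in> ?I")
      case True
      \<comment> \<open>The image of this triple displays the image of \<open>i\<close>, so equal
        actions on the lattice come from equal index permutations.\<close>
      let ?t = "({i}, {i}, {{}})"
      have "?t \<in> carrier ?L" using True by (auto simp: triple_in_carrier)
      then have "triple_map (map_sum \<pi> \<rho>) ?t = triple_map (map_sum \<pi>' \<rho>') ?t"
        using fxy unfolding eq f_def prod.case by (metis restrict_apply')
      then show ?thesis by (simp add: triple_map_def)
    next
      case False
      then show ?thesis
        using map_sum_permutes(1)[OF *(1,2)] map_sum_permutes(1)[OF *(3,4)] by (metis permutes_def)
    qed
    from this[of "Inl _"] this[of "Inr _"] show "x = y" by (auto simp: eq)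
  qed
  moreover have "f ` carrier (sym_group p \<times>\<times> sym_group q) = carrier (OrderAutoGroup ?L)"
  proof (intro equalityI subsetI)
    fix \<phi> assume "\<phi> \<in> carrier (OrderAutoGroup ?L)"
    \<comment> \<open>Surjectivity: the induced index permutation \<open>\<sigma>\<close> reproduces
      \<open>\<phi>\<close>, and since it preserves \<open>?Q\<close> it splits into a pair.\<close>
    then interpret triple_lattice_auto ?I ?Q \<phi>
      by unfold_locales (auto simp: carrier_OrderAutoGroup)
    obtain \<pi> \<rho> where "\<pi> permutes {1..p}" "\<rho> permutes {1..q}" "\<sigma> = map_sum \<pi> \<rho>"
      using permutes_Plus_imp_map_sum[OF _ _ \<sigma>_permutes \<sigma>_Q] by auto
    then show "\<phi> \<in> f ` carrier (sym_group p \<times>\<times> sym_group q)"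
      using \<phi>_eq_triple_map carr by (intro image_eqI[of _ _ "(\<pi>, \<rho>)"]) (auto simp: f_def)
  qed (use f_in in \<open>auto simp: carrier_OrderAutoGroup sym_group_carrier\<close>)
  ultimately have "f \<in> iso (sym_group p \<times>\<times> sym_group q) (OrderAutoGroup ?L)"
    by (simp add: iso_def bij_betw_def)
  then show ?thesis
    by (meson DirProd_group group.iso_sym is_isoI sym_group_is_group)
qed

section \<open>Normal subgroups of products of symmetric groups\<close>

locale sym_product =
  fixes I :: "'i set" and n :: "'i \<Rightarrow> nat"
  assumes fin: "finite I" and n_ge: "\<And>i. i \<in> I \<Longrightarrow> 3 \<le> n i"
begin

abbreviation "P \<equiv> product_group I (\<lambda>i. sym_group (n i))"

sublocale group P
  by (intro product_group sym_group_is_group)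

lemma in_P: "x \<in> carrier P \<longleftrightarrow> x \<in> extensional I \<and> (\<forall>i\<in>I. x i permutes {1..n i})"
  by (auto simp: PiE_iff sym_group_carrier)

lemma permutes_P: "x \<in> carrier P \<Longrightarrow> i \<in> I \<Longrightarrow> x i permutes {1..n i}"
  unfolding in_P by blast

lemma permutation_P: "x \<in> carrier P \<Longrightarrow> i \<in> I \<Longrightarrow> permutation (x i)"
  using permutes_P by (blast intro: permutes_imp_permutation)

lemma mult_P: "x \<otimes>\<^bsub>P\<^esub> y = (\<lambda>i\<in>I. x i \<circ> y i)"
  by (simp add: sym_group_mult)

lemma one_P: "\<one>\<^bsub>P\<^esub> = (\<lambda>i\<in>I. id)"
  by (simp add: sym_group_one)

lemma inv_P: "x \<in> carrier P \<Longrightarrow> inv\<^bsub>P\<^esub> x = (\<lambda>i\<in>I. inv' (x i))"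
  using sym_group_is_group by (auto simp: fun_eq_iff PiE_iff)

lemma conj_P:
  assumes "g \<in> carrier P" "x \<in> carrier P"
  shows "g \<otimes>\<^bsub>P\<^esub> x \<otimes>\<^bsub>P\<^esub> inv\<^bsub>P\<^esub> g = (\<lambda>i\<in>I. g i \<circ> x i \<circ> inv' (g i))"
  unfolding mult_P inv_P[OF assms(1)] by (auto simp: fun_eq_iff)

definition supp :: "('i \<Rightarrow> nat \<Rightarrow> nat) \<Rightarrow> 'i set"
  where "supp x = {i \<in> I. x i \<noteq> id}"

definition core_supp :: "('i \<Rightarrow> nat \<Rightarrow> nat) \<Rightarrow> 'i set"
  where "core_supp x = {i \<in> I. x i \<notin> sym_core (n i)}"

definition odds :: "('i \<Rightarrow> nat \<Rightarrow> nat) \<Rightarrow> 'i set"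
  where "odds x = {i \<in> I. \<not> evenperm (x i)}"

definition triple :: "('i \<Rightarrow> nat \<Rightarrow> nat) set \<Rightarrow> 'i set \<times> 'i set \<times> 'i set set"
  where "triple N = (\<Union> (supp ` N), \<Union> (core_supp ` N), odds ` N)"

text \<open>The inverse of \<open>triple\<close> on normal subgroups: everything that the prescribed
  levels and sign patterns allow.\<close>

definition of_triple :: "'i set \<times> 'i set \<times> 'i set set \<Rightarrow> ('i \<Rightarrow> nat \<Rightarrow> nat) set"
  where "of_triple = (\<lambda>(Z, F, W). {x \<in> carrier P. supp x \<subseteq> Z \<and> core_supp x \<subseteq> F \<and> odds x \<in> W})"

abbreviation "T \<equiv> carrier (triple_lattice I {i \<in> I. n i = 4})"

interpretation core: normal_in_sym m "sym_core m" for m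
  by (rule normal_in_sym.intro[OF sym_core_normal])

text \<open>These inclusions yield the carrier conditions of \<open>triple_lattice\<close>. The
  first holds because the core consists of even permutations, the last because the core is trivial
  unless the degree is 4.\<close>

lemma supp_subsets:
  "odds x \<subseteq> core_supp x" "core_supp x \<subseteq> supp x" "supp x \<subseteq> I"
    "supp x - core_supp x \<subseteq> {i \<in> I. n i = 4}"
proof -
  show "odds x \<subseteq> core_supp x"
    using sym_core_subset_alt_group by (fastforce simp: odds_def core_supp_def alt_group_carrier)
  show "core_supp x \<subseteq> supp x"
    using core.id_M by (auto simp: core_supp_def supp_def simp del: id_apply)
  show "supp x \<subseteq> I" by (auto simp: supp_def)
  show "supp x - core_supp x \<subseteq> {i \<in> I. n i = 4}"
    by (auto simp: core_supp_def supp_def sym_core_def split: if_splits)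
qed

lemma supp_mult:
  "supp (x \<otimes>\<^bsub>P\<^esub> y) \<subseteq> supp x \<union> supp y"
  "core_supp (x \<otimes>\<^bsub>P\<^esub> y) \<subseteq> core_supp x \<union> core_supp y"
  unfolding mult_P by (auto simp: supp_def core_supp_def intro: core.comp_M)

text \<open>Coordinatewise multiplicativity of the sign: \<open>odds\<close> is a homomorphism to
  \<open>GF(2)\<close>-vectors, which makes the sign patterns of a subgroup a linear code.\<close>

lemma odds_mult:
  assumes "x \<in> carrier P" "y \<in> carrier P"
  shows "odds (x \<otimes>\<^bsub>P\<^esub> y) = sym_diff (odds x) (odds y)"
proof -
  have "evenperm (x i \<circ> y i) \<longleftrightarrow> evenperm (x i) = evenperm (y i)" if "i \<in> I" for i
    using assms that by (intro evenperm_comp permutation_P)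
  then show ?thesis unfolding mult_P odds_def by auto
qed

lemma supp_inv:
  assumes "x \<in> carrier P"
  shows "supp (inv\<^bsub>P\<^esub> x) \<subseteq> supp x" "core_supp (inv\<^bsub>P\<^esub> x) \<subseteq> core_supp x"
    "odds (inv\<^bsub>P\<^esub> x) = odds x"
proof -
  have "evenperm (inv' (x i)) = evenperm (x i)" if "i \<in> I" for i
    using assms that by (intro evenperm_inv permutation_P)
  then show "odds (inv\<^bsub>P\<^esub> x) = odds x"
    unfolding inv_P[OF assms] odds_def by auto
  show "supp (inv\<^bsub>P\<^esub> x) \<subseteq> supp x" "core_supp (inv\<^bsub>P\<^esub> x) \<subseteq> core_supp x"
    unfolding inv_P[OF assms] supp_def core_supp_def by (auto dest: core.inv_M)qed

lemma supp_conj: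
  assumes g: "g \<in> carrier P" and x: "x \<in> carrier P"
  shows "supp (g \<otimes>\<^bsub>P\<^esub> x \<otimes>\<^bsub>P\<^esub> inv\<^bsub>P\<^esub> g) \<subseteq> supp x"
    "core_supp (g \<otimes>\<^bsub>P\<^esub> x \<otimes>\<^bsub>P\<^esub> inv\<^bsub>P\<^esub> g) \<subseteq> core_supp x"
    "odds (g \<otimes>\<^bsub>P\<^esub> x \<otimes>\<^bsub>P\<^esub> inv\<^bsub>P\<^esub> g) = odds x"
proof -
  have "g i \<circ> id \<circ> inv' (g i) = id" if "i \<in> I" for i
    using permutes_inv_o(1)[OF permutes_P[OF g that]] by simp
  then show "supp (g \<otimes>\<^bsub>P\<^esub> x \<otimes>\<^bsub>P\<^esub> inv\<^bsub>P\<^esub> g) \<subseteq> supp x"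
    unfolding conj_P[OF g x] supp_def by auto
  show "core_supp (g \<otimes>\<^bsub>P\<^esub> x \<otimes>\<^bsub>P\<^esub> inv\<^bsub>P\<^esub> g) \<subseteq> core_supp x"
    unfolding conj_P[OF g x] core_supp_def using core.conj_M[OF permutes_P[OF g]] by auto
  have gi: "inv\<^bsub>P\<^esub> g \<in> carrier P" using g by (rule inv_closed)
  show "odds (g \<otimes>\<^bsub>P\<^esub> x \<otimes>\<^bsub>P\<^esub> inv\<^bsub>P\<^esub> g) = odds x"
    unfolding odds_mult[OF m_closed[OF g x] gi] odds_mult[OF g x] supp_inv(3)[OF g] by blast
qed

lemma supp_one: "supp \<one>\<^bsub>P\<^esub> = {}" "core_supp \<one>\<^bsub>P\<^esub> = {}" "odds \<one>\<^bsub>P\<^esub> = {}"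
proof -
  show "supp \<one>\<^bsub>P\<^esub> = {}" unfolding one_P supp_def by simp
  then show "core_supp \<one>\<^bsub>P\<^esub> = {}" "odds \<one>\<^bsub>P\<^esub> = {}" using supp_subsets[of "\<one>\<^bsub>P\<^esub>"] by auto
qed

lemma in_of_triple:
  "x \<in> of_triple (Z, F, W) \<longleftrightarrow> x \<in> carrier P \<and> supp x \<subseteq> Z \<and> core_supp x \<subseteq> F \<and> odds x \<in> W"
  unfolding of_triple_def by blast

lemma of_triple_normal:
  assumes t: "t \<in> T"
  shows "of_triple t \<lhd> P"
proof -
  obtain Z F W where t': "t = (Z, F, W)" by (metis prod_cases3)
  have W: "{} \<in> W" "\<And>A B. A \<in> W \<Longrightarrow> B \<in> W \<Longrightarrow> sym_diff A B \<in> W"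
    using t[unfolded t' triple_in_carrier] by auto
  have "subgroup (of_triple t) P"
  proof (rule subgroupI)
    show "of_triple t \<subseteq> carrier P" unfolding t' using in_of_triple by blast
    have "\<one>\<^bsub>P\<^esub> \<in> of_triple t"
      unfolding t' in_of_triple supp_one using W(1) one_closed by blast
    then show "of_triple t \<noteq> {}" by blast
    fix x y assume "x \<in> of_triple t" and "y \<in> of_triple t"
    then have x: "x \<in> carrier P" "supp x \<subseteq> Z" "core_supp x \<subseteq> F" "odds x \<in> W"
      and y: "y \<in> carrier P" "supp y \<subseteq> Z" "core_supp y \<subseteq> F" "odds y \<in> W"
      unfolding t' in_of_triple by blast+
    show "inv\<^bsub>P\<^esub> x \<in> of_triple t"
      unfolding t' in_of_triple
      using x(2,3) supp_inv(1,2)[OF x(1)] by (auto simp only: supp_inv(3)[OF x(1)] x(4) inv_closed[OF x(1)])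
    show "x \<otimes>\<^bsub>P\<^esub> y \<in> of_triple t"
      unfolding t' in_of_triple odds_mult[OF x(1) y(1)]
      using x(2,3) y(2,3) supp_mult[of x y] W(2)[OF x(4) y(4)] m_closed[OF x(1) y(1)] by blast
  qed
  moreover have "g \<otimes>\<^bsub>P\<^esub> x \<otimes>\<^bsub>P\<^esub> inv\<^bsub>P\<^esub> g \<in> of_triple t"
    if g: "g \<in> carrier P" and "x \<in> of_triple t" for g x
  proof -
    have x: "x \<in> carrier P" "supp x \<subseteq> Z" "core_supp x \<subseteq> F" "odds x \<in> W"
      using that(2) unfolding t' in_of_triple by blast+
    show ?thesis
      unfolding t' in_of_triple supp_conj(3)[OF g x(1)]
      using x(2-4) supp_conj(1,2)[OF g x(1)] m_closed[OF m_closed[OF g x(1)] inv_closed[OF g]] by blast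
  qed
  ultimately show ?thesis unfolding normal_inv_iff by blast
qed

definition single :: "'i \<Rightarrow> (nat \<Rightarrow> nat) \<Rightarrow> 'i \<Rightarrow> nat \<Rightarrow> nat"
  where "single i g = (\<lambda>j\<in>I. if j = i then g else id)"

lemma single_in_P: "g permutes {1..n i} \<Longrightarrow> single i g \<in> carrier P"
  unfolding in_P single_def by (simp add: permutes_id del: id_apply)

lemma supp_single:
  assumes "i \<in> I"
  shows "supp (single i g) = (if g = id then {} else {i})"
    "core_supp (single i g) = (if g \<in> sym_core (n i) then {} else {i})"
    "odds (single i g) = (if evenperm g then {} else {i})"
  using assms core.id_M by (auto simp: supp_def core_supp_def odds_def single_def simp del: id_apply split: if_splits)

lemma single_in_of_triple:
  assumes t: "(Z, F, W) \<in> T" and i: "i \<in> Z" and g: "g \<in> carrier (alt_group (n i))"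
    "g \<notin> sym_core (n i) \<Longrightarrow> i \<in> F"
  shows "single i g \<in> of_triple (Z, F, W)"
proof -
  have "i \<in> I" using t i by (auto simp: triple_in_carrier)
  then show ?thesis
    using t i g single_in_P[of g i] unfolding in_of_triple
    by (auto simp only: supp_single alt_group_carrier triple_in_carrier split: if_splits)
qed

text \<open>Each prescribed datum needs a witness in the subgroup: an even element in a single
  factor for every index of \<open>Z\<close> or \<open>F\<close>, and an element with the given sign
  pattern for every vector of \<open>W\<close>.\<close>

lemma triple_of_triple:
  assumes t: "t \<in> T"
  shows "triple (of_triple t) = t"
proof -
  obtain Z F W where t': "t = (Z, F, W)" by (metis prod_cases3)
  note T = t[unfolded t' triple_in_carrier]
  have "Z \<subseteq> \<Union> (supp ` of_triple t)"
  proof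
    fix i assume i: "i \<in> Z"
    then have iI: "i \<in> I" using T by blast
    \<comment> \<open>Evenness makes the sign pattern empty, hence allowed. Where \<open>i\<close>
      is missing from \<open>F\<close> the degree is 4, and a nontrivial element of
      \<open>klein_four\<close> stays inside the core.\<close>
    have "\<exists>g\<in>carrier (alt_group (n i)). g \<noteq> id \<and> (g \<notin> sym_core (n i) \<longrightarrow> i \<in> F)"
    proof (cases "i \<in> F")
      case True
      then show ?thesis using ex_alt_group_not_core[OF n_ge[OF iI]] core.id_M by metis
    next
      case False
      then have n: "n i = 4" using T i by blast
      obtain g where "g \<in> klein_four" "g \<noteq> id" by (rule ex_klein_four_nontrivial)
      then show ?thesis
        using klein_four_subset_alt_group unfolding n by (auto simp: sym_core_def simp del: id_apply)
    qed
    then obtain g where "single i g \<in> of_triple t" "g \<noteq> id"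
      using single_in_of_triple[OF t[unfolded t'] i] unfolding t' by blast
    moreover from this(2) have "i \<in> supp (single i g)" by (simp only: supp_single(1)[OF iI] if_False singletonI)
    ultimately show "i \<in> \<Union> (supp ` of_triple t)" by (intro UN_I)
  qed
  moreover have "F \<subseteq> \<Union> (core_supp ` of_triple t)"
  proof
    fix i assume i: "i \<in> F"
    then have iZ: "i \<in> Z" and iI: "i \<in> I" using T by auto
    obtain g where "g \<in> carrier (alt_group (n i))" "g \<notin> sym_core (n i)"
      using ex_alt_group_not_core[OF n_ge[OF iI]] .
    then have "single i g \<in> of_triple t" "i \<in> core_supp (single i g)"
      using single_in_of_triple[OF t[unfolded t'] iZ] i unfolding t'
      by (simp_all only: supp_single(2)[OF iI] if_False singletonI)
    then show "i \<in> \<Union> (core_supp ` of_triple t)" by (intro UN_I)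
  qed
  moreover have "W \<subseteq> odds ` of_triple t"
  proof
    fix J assume J: "J \<in> W"
    \<comment> \<open>One transposition at each index of \<open>J\<close>: odd exactly on
      \<open>J\<close>, trivial elsewhere.\<close>
    let ?x = "\<lambda>i\<in>I. if i \<in> J then transpose 1 2 else id"
    have JF: "J \<subseteq> F" "J \<subseteq> I" "J \<subseteq> Z" using J T by blast+
    have "transpose 1 2 permutes {1..n i}" if "i \<in> I" for i
      using n_ge[OF that] by (intro permutes_swap_id) auto
    then have xP: "?x \<in> carrier P" unfolding in_P by (auto simp: permutes_id simp del: id_apply)
    have "transpose 1 (2 :: nat) \<noteq> id" by (metis id_apply n_not_Suc_n numeral_2_eq_2 One_nat_def transpose_apply_first)
    then have "supp ?x \<subseteq> J" by (auto simp: supp_def split: if_splits)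
    moreover have "odds ?x = J" using JF by (auto simp: odds_def evenperm_swap split: if_splits)
    ultimately have "?x \<in> of_triple t"
      unfolding t' in_of_triple using xP J JF(1,3) supp_subsets(2)[of ?x]
      by (metis (no_types, lifting) subset_trans)
    with \<open>odds ?x = J\<close> show "J \<in> odds ` of_triple t" by (intro image_eqI) (rule sym)
  qed
  ultimately show ?thesis
    unfolding triple_def t' in_of_triple by (auto simp only: in_of_triple)
qed

lemma triple_in_T:
  assumes "N \<lhd> P"
  shows "triple N \<in> T"
proof -
  have N: "subgroup N P" using assms by (rule normal_imp_subgroup)
  have "sym_diff (odds x) (odds y) \<in> odds ` N" if xy: "x \<in> N" "y \<in> N" for x y
  proof -
    have "odds (x \<otimes>\<^bsub>P\<^esub> y) = sym_diff (odds x) (odds y)"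
      using subgroup.mem_carrier[OF N] xy by (intro odds_mult)
    then show ?thesis using subgroup.m_closed[OF N xy] by (rule image_eqI[OF sym])
  qed
  then have "\<forall>A\<in>odds ` N. \<forall>B\<in>odds ` N. sym_diff A B \<in> odds ` N"
    by (intro ballI, elim imageE, simp only:)
  moreover have "{} \<in> odds ` N"
    using supp_one(3) subgroup.one_closed[OF N] by (rule image_eqI[OF sym])
  moreover have "odds ` N \<subseteq> Pow (\<Union> (core_supp ` N))" using supp_subsets(1) by blast
  moreover have "\<Union> (supp ` N) - \<Union> (core_supp ` N) \<subseteq> {i \<in> I. n i = 4}" using supp_subsets(4) by blast
  moreover have "\<Union> (core_supp ` N) \<subseteq> \<Union> (supp ` N)" "\<Union> (supp ` N) \<subseteq> I"
    using supp_subsets(2,3) by blast+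
  ultimately show ?thesis unfolding triple_def triple_in_carrier by (intro conjI)
qed

end

section \<open>Recovering a normal subgroup of the product from its triple\<close>

locale normal_in_sym_product = sym_product +
  fixes N
  assumes N: "N \<lhd> P"
begin

lemma N_subset: "x \<in> N \<Longrightarrow> x \<in> carrier P"
  by (rule subgroup.mem_carrier[OF normal_imp_subgroup[OF N]])

lemma N_mult: "x \<in> N \<Longrightarrow> y \<in> N \<Longrightarrow> x \<otimes>\<^bsub>P\<^esub> y \<in> N"
  by (rule subgroup.m_closed[OF normal_imp_subgroup[OF N]])

lemma N_inv: "x \<in> N \<Longrightarrow> inv\<^bsub>P\<^esub> x \<in> N"
  by (rule subgroup.m_inv_closed[OF normal_imp_subgroup[OF N]])

lemma N_one: "\<one>\<^bsub>P\<^esub> \<in> N"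
  by (rule subgroup.one_closed[OF normal_imp_subgroup[OF N]])

lemma N_conj: "g \<in> carrier P \<Longrightarrow> x \<in> N \<Longrightarrow> g \<otimes>\<^bsub>P\<^esub> x \<otimes>\<^bsub>P\<^esub> inv\<^bsub>P\<^esub> g \<in> N"
  by (rule normal.inv_op_closed2[OF N])

text \<open>The intersection of \<open>N\<close> with a factor, as opposed to the projection of
  \<open>N\<close> to it; commutators connect the two.\<close>

definition slice :: "'a \<Rightarrow> (nat \<Rightarrow> nat) set"
  where "slice i = {g. g permutes {1..n i} \<and> single i g \<in> N}"

lemma single_mult: "single i g \<otimes>\<^bsub>P\<^esub> single i h = single i (g \<circ> h)"
  unfolding mult_P single_def by (auto simp: fun_eq_iff)

lemma single_inv:
  assumes "g permutes {1..n i}"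
  shows "inv\<^bsub>P\<^esub> (single i g) = single i (inv' g)"
  unfolding inv_P[OF single_in_P[OF assms]] by (auto simp: single_def fun_eq_iff)

lemma slice_normal: "normal_in_sym (n i) (slice i)"
proof -
  interpret S: group "sym_group (n i)" by (rule sym_group_is_group)
  have "subgroup (slice i) (sym_group (n i))"
  proof (rule S.subgroupI)
    show "slice i \<subseteq> carrier (sym_group (n i))"
      by (auto simp: slice_def sym_group_carrier)
    have "single i id = \<one>\<^bsub>P\<^esub>" unfolding one_P single_def by auto
    then show "slice i \<noteq> {}" using N_one permutes_id unfolding slice_def by fastforce
    fix g h assume "g \<in> slice i" and "h \<in> slice i"
    then have g: "g permutes {1..n i}" "single i g \<in> N" and h: "h permutes {1..n i}" "single i h \<in> N"
      by (simp_all only: slice_def mem_Collect_eq)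
    have "inv\<^bsub>sym_group (n i)\<^esub> g = inv' g" using g(1) by (simp add: sym_group_carrier)
    then show "inv\<^bsub>sym_group (n i)\<^esub> g \<in> slice i"
      using N_inv[OF g(2)] permutes_inv[OF g(1)] by (simp only: slice_def mem_Collect_eq single_inv[OF g(1)])
    show "g \<otimes>\<^bsub>sym_group (n i)\<^esub> h \<in> slice i"
      using N_mult[OF g(2) h(2)] permutes_compose[OF h(1) g(1)]
      by (simp only: slice_def sym_group_mult mem_Collect_eq single_mult)
  qed
  moreover have "g \<circ> h \<circ> inv' g \<in> slice i" if g: "g permutes {1..n i}" and h: "h \<in> slice i" for g h
    using N_conj[OF single_in_P[OF g], of "single i h"] h g
    unfolding single_inv[OF g] single_mult slice_def
    by (simp add: permutes_compose permutes_inv del: comp_apply)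
  ultimately show ?thesis
    by (intro normal_in_sym.intro) (auto simp: S.normal_inv_iff sym_group_mult sym_group_carrier simp del: comp_apply)
qed

text \<open>The commutator of \<open>x\<close> with an element of a single factor is trivial at all
  other indices.\<close>

lemma commutator_in_slice:
  assumes x: "x \<in> N" and i: "i \<in> I" and h: "h permutes {1..n i}"
  shows "x i \<circ> h \<circ> inv' (x i) \<circ> inv' h \<in> slice i"
proof -
  have xP: "x \<in> carrier P" using x by (rule N_subset)
  \<comment> \<open>This bracketing exhibits the commutator as \<open>x\<close> times a conjugate of
    its inverse, so it lies in \<open>N\<close>.\<close>
  have "x \<otimes>\<^bsub>P\<^esub> (single i h \<otimes>\<^bsub>P\<^esub> inv\<^bsub>P\<^esub> x \<otimes>\<^bsub>P\<^esub> inv\<^bsub>P\<^esub> (single i h)) \<in> N"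
    using x h by (intro N_mult N_conj single_in_P N_inv)
  moreover have "x \<otimes>\<^bsub>P\<^esub> (single i h \<otimes>\<^bsub>P\<^esub> inv\<^bsub>P\<^esub> x \<otimes>\<^bsub>P\<^esub> inv\<^bsub>P\<^esub> (single i h)) =
      single i (x i \<circ> h \<circ> inv' (x i) \<circ> inv' h)"
  proof
    fix j
    show "(x \<otimes>\<^bsub>P\<^esub> (single i h \<otimes>\<^bsub>P\<^esub> inv\<^bsub>P\<^esub> x \<otimes>\<^bsub>P\<^esub> inv\<^bsub>P\<^esub> (single i h))) j =
        single i (x i \<circ> h \<circ> inv' (x i) \<circ> inv' h) j"
      using permutes_inv_o(1)[OF permutes_P[OF xP]]
      unfolding single_inv[OF h] inv_P[OF xP] mult_P
      by (auto simp: single_def comp_assoc simp del: comp_apply)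
  qed
  moreover have "x i \<circ> h \<circ> inv' (x i) \<circ> inv' h permutes {1..n i}"
    using permutes_P[OF xP i] h by (intro permutes_compose permutes_inv)
  ultimately show ?thesis by (simp only: slice_def mem_Collect_eq)
qed

lemma slice_supersets:
  assumes x: "x \<in> N"
  shows "i \<in> supp x \<Longrightarrow> sym_core (n i) \<subseteq> slice i"
    and "i \<in> core_supp x \<Longrightarrow> carrier (alt_group (n i)) \<subseteq> slice i"
proof -
  have *: "x i permutes {1..n i}" "\<forall>h. h permutes {1..n i} \<longrightarrow> x i \<circ> h \<circ> inv' (x i) \<circ> inv' h \<in> slice i"
    "3 \<le> n i" if "i \<in> I" for i
    using commutator_in_slice[OF x that] permutes_P[OF N_subset[OF x] that] n_ge[OF that] by blast+
  show "sym_core (n i) \<subseteq> slice i" if "i \<in> supp x"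
  proof -
    have "i \<in> I" "x i \<noteq> id" using that unfolding supp_def by blast+
    then show ?thesis by (intro normal_in_sym.commutators_subset(1)[OF slice_normal, of "x i"] *)
  qed
  show "carrier (alt_group (n i)) \<subseteq> slice i" if "i \<in> core_supp x"
  proof -
    have "i \<in> I" "x i \<notin> sym_core (n i)" using that unfolding core_supp_def by blast+
    then show ?thesis by (intro normal_in_sym.commutators_subset(2)[OF slice_normal, of "x i"] *)
  qed
qed

text \<open>As \<open>I\<close> is finite, \<open>y\<close> is a product of its single components;
  the induction multiplies them in one at a time.\<close>

lemma in_N_if_components:
  assumes y: "y \<in> carrier P" and "\<And>i. i \<in> I \<Longrightarrow> y i \<in> slice i"
  shows "y \<in> N"
proof -
  have "J \<subseteq> I \<Longrightarrow> (\<lambda>i\<in>I. if i \<in> J then y i else id) \<in> N" if "finite J" for J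
    using that
  proof (induction J)
    case empty
    show ?case using N_one by (simp only: one_P empty_iff if_False)
  next
    case (insert j J)
    have "(\<lambda>i\<in>I. if i \<in> insert j J then y i else id) =
        single j (y j) \<otimes>\<^bsub>P\<^esub> (\<lambda>i\<in>I. if i \<in> J then y i else id)"
      using insert.hyps unfolding mult_P single_def by (auto simp: fun_eq_iff)
    moreover have "single j (y j) \<in> N" using assms(2)[of j] insert.prems by (simp add: slice_def)
    moreover have "(\<lambda>i\<in>I. if i \<in> J then y i else id) \<in> N" using insert.IH insert.prems by blast
    ultimately show ?case by (simp only: N_mult)
  qed
  from this[OF fin order_refl] have "restrict y I \<in> N" by (simp cong: restrict_cong)
  then show ?thesis using y by (simp only: in_P extensional_restrict)
qed

lemma of_triple_triple: "of_triple (triple N) = N"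
proof (intro equalityI subsetI)
  fix x assume "x \<in> N"
  then show "x \<in> of_triple (triple N)"
    using N_subset unfolding of_triple_def triple_def by blast
next
  fix x assume "x \<in> of_triple (triple N)"
  then have x: "x \<in> carrier P" "supp x \<subseteq> \<Union> (supp ` N)" "core_supp x \<subseteq> \<Union> (core_supp ` N)" "odds x \<in> odds ` N"
    unfolding of_triple_def triple_def by blast+
  obtain y where y: "y \<in> N" "odds x = odds y" using x(4) by blast
  have yP: "y \<in> carrier P" using y(1) by (rule N_subset)
  \<comment> \<open>Dividing \<open>x\<close> by an element \<open>y\<close> of \<open>N\<close>
    with the same sign pattern leaves an element even in every component, whose supports are still
    covered by those of \<open>N\<close>. It can then be assembled from the slices.\<close>
  define z where "z = x \<otimes>\<^bsub>P\<^esub> inv\<^bsub>P\<^esub> y"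
  have zP: "z \<in> carrier P" unfolding z_def by (intro m_closed inv_closed x(1) yP)
  have "supp (inv\<^bsub>P\<^esub> y) \<subseteq> \<Union> (supp ` N)" "core_supp (inv\<^bsub>P\<^esub> y) \<subseteq> \<Union> (core_supp ` N)"
    using supp_inv(1,2)[OF yP] y(1) by blast+
  then have supp_z: "supp z \<subseteq> \<Union> (supp ` N)" "core_supp z \<subseteq> \<Union> (core_supp ` N)"
    unfolding z_def using supp_mult[of x "inv\<^bsub>P\<^esub> y"] x(2,3) by (meson Un_least subset_trans)+
  have odds_z: "odds z = {}"
    unfolding z_def odds_mult[OF x(1) inv_closed[OF yP]] supp_inv(3)[OF yP] y(2) by blast
  have "z \<in> N"
  proof (rule in_N_if_components[OF zP])
    fix i assume i: "i \<in> I"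
    \<comment> \<open>The three levels: the trivial component is in any slice, a core component is
      covered by \<open>sym_core\<close>, and any other component is even and covered by the
      alternating group.\<close>
    consider "z i = id" | "i \<in> supp z" "z i \<in> sym_core (n i)" | "i \<in> core_supp z"
      using i by (auto simp: supp_def core_supp_def simp del: id_apply)
    then show "z i \<in> slice i"
    proof cases
      case 1
      then show ?thesis using normal_in_sym.id_M[OF slice_normal] by simp
    next
      case 2
      then show ?thesis using supp_z(1) slice_supersets(1) by blast
    next
      case 3
      have "z i \<in> carrier (alt_group (n i))"
        using odds_z permutes_P[OF zP i] i by (auto simp: odds_def alt_group_carrier)
      then show ?thesis using 3 supp_z(2) slice_supersets(2) by blast
    qed
  qed
  then have "z \<otimes>\<^bsub>P\<^esub> y \<in> N" using y(1) by (rule N_mult)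
  moreover have "z \<otimes>\<^bsub>P\<^esub> y = x"
    unfolding z_def using x(1) yP m_assoc[OF x(1) inv_closed[OF yP] yP] l_inv[OF yP] r_one[OF x(1)] by metis
  ultimately show "x \<in> N" by simp
qed

end

context sym_product
begin

lemma LatAut_cong: "LatAut P \<cong> OrderAutoGroup (triple_lattice I {i \<in> I. n i = 4})"
  unfolding LatAut_def
proof (rule OrderAutoGroup_cong[where f = triple])
  have of_triple_triple: "of_triple (triple N) = N" if "N \<lhd> P" for N
    by (intro normal_in_sym_product.of_triple_triple normal_in_sym_product.intro
        normal_in_sym_product_axioms.intro sym_product_axioms that)
  show "bij_betw triple (carrier (normal_subgroup_lattice P)) T"
    by (rule bij_betw_byWitness[where f' = of_triple])
      (use of_triple_triple triple_of_triple triple_in_T of_triple_normal in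
        \<open>auto simp: normal_subgroup_lattice_def\<close>)
  fix N M assume "N \<in> carrier (normal_subgroup_lattice P)" "M \<in> carrier (normal_subgroup_lattice P)"
  then have NM: "N \<lhd> P" "M \<lhd> P" by (auto simp: normal_subgroup_lattice_def)
  have mono: "of_triple s \<subseteq> of_triple t" if "s \<sqsubseteq>\<^bsub>triple_lattice I {i \<in> I. n i = 4}\<^esub> t" for s t
    using that by (cases s; cases t) (auto simp: of_triple_def)
  have "triple N \<sqsubseteq>\<^bsub>triple_lattice I {i \<in> I. n i = 4}\<^esub> triple M \<longleftrightarrow> N \<subseteq> M"
  proof
    assume "triple N \<sqsubseteq>\<^bsub>triple_lattice I {i \<in> I. n i = 4}\<^esub> triple M"
    then show "N \<subseteq> M" using mono of_triple_triple NM by metis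
  next
    assume "N \<subseteq> M"
    then show "triple N \<sqsubseteq>\<^bsub>triple_lattice I {i \<in> I. n i = 4}\<^esub> triple M"
      unfolding triple_def by auto
  qed
  then show "triple N \<sqsubseteq>\<^bsub>triple_lattice I {i \<in> I. n i = 4}\<^esub> triple M \<longleftrightarrow>
      N \<sqsubseteq>\<^bsub>normal_subgroup_lattice P\<^esub> M"
    by (simp add: normal_subgroup_lattice_def)
qed

end

section \<open>Transfer to tower groups\<close>

lemma LatAut_iso:
  assumes G: "group G" and H: "group H" and iso: "G \<cong> H"
  shows "LatAut G \<cong> LatAut H"
proof -
  obtain f where f: "f \<in> iso G H" using iso by (auto simp: is_iso_def)
  define g where "g = inv_into (carrier G) f"
  have g: "g \<in> iso H G" unfolding g_def by (rule group.iso_set_sym[OF G f])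
  have inj: "inj_on f (carrier G)" and surj: "f ` carrier G = carrier H"
    using f by (auto simp: iso_def bij_betw_def)
  have gf: "g ` f ` N = N" if "N \<lhd> G" for N
    unfolding g_def using inj subgroup.subset[OF normal_imp_subgroup[OF that]]
    by (rule inv_into_image_cancel)
  have fg: "f ` g ` N = N" if "N \<lhd> H" for N
    unfolding g_def using surj subgroup.subset[OF normal_imp_subgroup[OF that]]
    by (rule image_inv_into_cancel)
  show ?thesis
    unfolding LatAut_def
  proof (rule OrderAutoGroup_cong[where f = "image f"])
    show "bij_betw (image f) (carrier (normal_subgroup_lattice G)) (carrier (normal_subgroup_lattice H))"
      by (rule bij_betw_byWitness[where f' = "image g"])
        (use gf fg iso_normal_subgroup[OF f G H] iso_normal_subgroup[OF g H G] in
          \<open>auto simp: normal_subgroup_lattice_def\<close>)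
    fix N M assume "N \<in> carrier (normal_subgroup_lattice G)" "M \<in> carrier (normal_subgroup_lattice G)"
    then have NM: "N \<lhd> G" "M \<lhd> G" by (auto simp: normal_subgroup_lattice_def)
    have "f ` N \<subseteq> f ` M \<longleftrightarrow> N \<subseteq> M"
      using gf[OF NM(1)] gf[OF NM(2)] by (metis image_mono)
    then show "f ` N \<sqsubseteq>\<^bsub>normal_subgroup_lattice H\<^esub> f ` M \<longleftrightarrow> N \<sqsubseteq>\<^bsub>normal_subgroup_lattice G\<^esub> M"
      by (simp add: normal_subgroup_lattice_def)
  qed
qed

text \<open>Flattens the nested product into one product over pairs, renamed by
  \<open>\<gamma>\<close>; currying gives the inverse. The outer index set may be infinite while the
  set of pairs is finite, as happens for tower groups.\<close>

lemma product_group_reindex: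
  fixes G :: "'k \<Rightarrow> ('g, 'm) monoid_scheme"
  assumes \<gamma>: "bij_betw (\<gamma> :: 'a \<Rightarrow> 'k \<times> 'b) J (SIGMA k:A. B k)"
  shows "product_group A (\<lambda>k. product_group (B k) (\<lambda>_. G k)) \<cong> product_group J (\<lambda>i. G (fst (\<gamma> i)))"
    (is "?L \<cong> ?R")
proof -
  define f where "f = (\<lambda>x :: 'k \<Rightarrow> 'b \<Rightarrow> 'g. \<lambda>i\<in>J. x (fst (\<gamma> i)) (snd (\<gamma> i)))"
  define g where "g = (\<lambda>y :: 'a \<Rightarrow> 'g. \<lambda>k\<in>A. \<lambda>j\<in>B k. y (inv_into J \<gamma> (k, j)))"
  have \<gamma>in: "fst (\<gamma> i) \<in> A" "snd (\<gamma> i) \<in> B (fst (\<gamma> i))" if "i \<in> J" for i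
    using bij_betwE[OF \<gamma>] that by (auto simp: split_beta)
  have inv: "inv_into J \<gamma> (\<gamma> i) = i" if "i \<in> J" for i
    using \<gamma> that by (auto simp: bij_betw_def)
  have inv2: "inv_into J \<gamma> (k, j) \<in> J" "\<gamma> (inv_into J \<gamma> (k, j)) = (k, j)" if "k \<in> A" "j \<in> B k" for k j
    using \<gamma> that by (auto simp: bij_betw_def intro!: inv_into_into f_inv_into_f)
  have "f \<in> hom ?L ?R"
    using \<gamma>in by (intro homI) (auto simp: f_def PiE_iff fun_eq_iff)
  moreover have "bij_betw f (carrier ?L) (carrier ?R)"
  proof (rule bij_betw_byWitness[where f' = g])
    show "\<forall>x\<in>carrier ?L. g (f x) = x"
      using inv2 by (auto simp: f_def g_def PiE_iff fun_eq_iff extensional_def)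
    show "\<forall>y\<in>carrier ?R. f (g y) = y"
      using inv \<gamma>in by (auto simp: f_def g_def PiE_iff fun_eq_iff extensional_def)
    show "f ` carrier ?L \<subseteq> carrier ?R"
      using \<gamma>in by (auto simp: f_def PiE_iff)
    show "g ` carrier ?R \<subseteq> carrier ?L"
    proof clarsimp
      fix y k j assume y: "y \<in> (\<Pi>\<^sub>E i\<in>J. carrier (G (fst (\<gamma> i))))"
      show "g y \<in> (\<Pi>\<^sub>E k\<in>A. B k \<rightarrow>\<^sub>E carrier (G k))"
      proof (rule PiE_I)
        fix k assume k: "k \<in> A"
        have "y (inv_into J \<gamma> (k, j)) \<in> carrier (G k)" if "j \<in> B k" for j
          using PiE_mem[OF y inv2(1)[OF k that]] inv2(2)[OF k that] by simp
        then show "g y k \<in> B k \<rightarrow>\<^sub>E carrier (G k)" using k by (auto simp: g_def)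
      qed (simp add: g_def)
    qed
  qed
  ultimately show ?thesis by (auto simp: is_iso_def iso_def)
qed

text \<open>Numbers the factors so that the left summand indexes exactly the copies of
  \<open>S_4\<close>, matching the form in which the automorphisms of the triple lattice are
  computed.\<close>

lemma tower_index:
  fixes a :: "nat \<Rightarrow> nat"
  assumes fin: "finite {k. 3 \<le> k \<and> a k \<noteq> 0}"
  obtains \<gamma> where "bij_betw \<gamma> (Sum_Type.Plus {1..a 4} {1..\<Sum>k | 3 \<le> k \<and> k \<noteq> 4 \<and> a k \<noteq> 0. a k}) (SIGMA k:{3..}. {..<a k})"
    "\<And>i. i \<in> Sum_Type.Plus {1..a 4} {1..\<Sum>k | 3 \<le> k \<and> k \<noteq> 4 \<and> a k \<noteq> 0. a k} \<Longrightarrow> fst (\<gamma> i) = 4 \<longleftrightarrow> i \<in> Inl ` {1..a 4}"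
proof -
  \<comment> \<open>Restricting to nonzero multiplicities keeps the index set finite; a sum over an
    infinite set would be 0 by convention.\<close>
  define K where "K = {k. 3 \<le> k \<and> k \<noteq> 4 \<and> a k \<noteq> 0}"
  have finK: "finite K" using fin by (rule rev_finite_subset) (auto simp: K_def)
  obtain \<alpha> where \<alpha>: "bij_betw \<alpha> {1..a 4} {..<a 4}"
    using finite_same_card_bij[of "{1..a 4}" "{..<a 4}"] by auto
  have "card {1..\<Sum>k\<in>K. a k} = card (SIGMA k:K. {..<a k})" using finK by simp
  then obtain \<beta> where \<beta>: "bij_betw \<beta> {1..\<Sum>k\<in>K. a k} (SIGMA k:K. {..<a k})"
    using finite_same_card_bij[of "{1..\<Sum>k\<in>K. a k}" "SIGMA k:K. {..<a k}"] finK by auto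
  define \<gamma> where "\<gamma> = case_sum (\<lambda>i. (4 :: nat, \<alpha> i)) \<beta>"
  have \<beta>K: "fst (\<beta> j) \<in> K" if "j \<in> {1..\<Sum>k\<in>K. a k}" for j
    using bij_betwE[OF \<beta>] that by force
  have img: "\<gamma> ` Inl ` {1..a 4} = {4} \<times> {..<a 4}" "\<gamma> ` Inr ` {1..\<Sum>k\<in>K. a k} = (SIGMA k:K. {..<a k})"
    using \<alpha> \<beta> by (auto simp: \<gamma>_def image_image bij_betw_def)
  have "inj_on \<gamma> (Sum_Type.Plus {1..a 4} {1..\<Sum>k\<in>K. a k})"
  proof (rule inj_onI)
    fix i j assume ij: "i \<in> Sum_Type.Plus {1..a 4} {1..\<Sum>k\<in>K. a k}"
      "j \<in> Sum_Type.Plus {1..a 4} {1..\<Sum>k\<in>K. a k}" "\<gamma> i = \<gamma> j"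
    have inj: "inj_on \<alpha> {1..a 4}" "inj_on \<beta> {1..\<Sum>k\<in>K. a k}"
      using \<alpha> \<beta> by (simp_all add: bij_betw_def)
    \<comment> \<open>The values on the two summands cannot collide, since 4 is excluded from
      \<open>K\<close>.\<close>
    have ne: "\<beta> y \<noteq> (4, x)" if "y \<in> {1..\<Sum>k\<in>K. a k}" for x y
      using \<beta>K[OF that] by (auto simp: K_def)
    show "i = j"
    proof (cases i; cases j)
      fix x y assume "i = Inl x" "j = Inl y"
      then show ?thesis using ij inj_onD[OF inj(1), of x y] by (auto simp: \<gamma>_def)
    next
      fix x y assume "i = Inr x" "j = Inr y"
      then show ?thesis using ij inj_onD[OF inj(2), of x y] by (auto simp: \<gamma>_def)
    next
      fix x y assume "i = Inl x" "j = Inr y"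
      then show ?thesis using ij ne[of y "\<alpha> x"] by (auto simp: \<gamma>_def)
    next
      fix x y assume "i = Inr x" "j = Inl y"
      then show ?thesis using ij ne[of x "\<alpha> y"] by (auto simp: \<gamma>_def)
    qed
  qed
  moreover have "\<gamma> ` Sum_Type.Plus {1..a 4} {1..\<Sum>k\<in>K. a k} = (SIGMA k:{3..}. {..<a k})"
    unfolding Sum_Type.Plus_def image_Un img by (auto simp: K_def)
  moreover have "fst (\<gamma> i) = 4 \<longleftrightarrow> i \<in> Inl ` {1..a 4}" if "i \<in> Sum_Type.Plus {1..a 4} {1..\<Sum>k\<in>K. a k}" for i
    using that \<beta>K by (cases i) (auto simp: \<gamma>_def K_def)
  ultimately show thesis using that[of \<gamma>] by (simp add: bij_betw_def K_def)
qed

theorem theorem1p1: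
  fixes G :: "('g, 'm) monoid_scheme" and a :: "nat \<Rightarrow> nat"
  assumes "tower_group a G"
  shows "LatAut G \<cong> sym_group (a 4) \<times>\<times> sym_group (\<Sum>k | 3 \<le> k \<and> k \<noteq> 4 \<and> a k \<noteq> 0. a k)"
proof -
  let ?q = "\<Sum>k | 3 \<le> k \<and> k \<noteq> 4 \<and> a k \<noteq> 0. a k"
  let ?I = "Sum_Type.Plus {1..a 4} {1..?q}"
  have G: "group G" "finite {k. 3 \<le> k \<and> a k \<noteq> 0}" "G \<cong> symmetric_product a"
    using assms by (auto simp: tower_group_def)
  obtain \<gamma> where \<gamma>: "bij_betw \<gamma> ?I (SIGMA k:{3..}. {..<a k})"
    and four: "\<And>i. i \<in> ?I \<Longrightarrow> fst (\<gamma> i) = 4 \<longleftrightarrow> i \<in> Inl ` {1..a 4}"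
    by (rule tower_index[OF G(2)]) blast
  \<comment> \<open>The bound on the degrees holds because \<open>\<gamma>\<close> maps into pairs
    whose first component is at least 3.\<close>
  interpret sym_product ?I "\<lambda>i. fst (\<gamma> i)"
    using bij_betwE[OF \<gamma>] by unfold_locales force+
  have "G \<cong> P"
    using G(3) product_group_reindex[OF \<gamma>, of sym_group]
    unfolding symmetric_product_def by (rule iso_trans)
  then have "LatAut G \<cong> LatAut P"
    using G(1) is_group by (rule LatAut_iso[rotated 2])
  also have "LatAut P \<cong> OrderAutoGroup (triple_lattice ?I {i \<in> ?I. fst (\<gamma> i) = 4})"
    by (rule LatAut_cong)
  also have "{i \<in> ?I. fst (\<gamma> i) = 4} = Inl ` {1..a 4}"
    using four by blast
  also have "OrderAutoGroup (triple_lattice ?I (Inl ` {1..a 4})) \<cong> sym_group (a 4) \<times>\<times> sym_group ?q"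
    by (rule OrderAutoGroup_triple_lattice)
  finally show ?thesis .
qed

end
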